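(* Let $R$ be a unital ring that is strongly graded by the group $G$ with identity element $e$. Suppose that $H$ is a subgroup of $G$. Then $R/R_H$ is separable if and only if $[G:H]$ is finite and there exists $r \in C_{R_e}(R_H)$ such that $\mathrm{tr}_{G/H}(r) = 1_R$.
   Context: A unital ring has $1\neq 0$. A ring $R$ is graded by a group $G$ if there are additive subgroups $R_g$ ($g\in G$) with $R=\bigoplus_{g\in G} R_g$ and $R_gR_h\subseteq R_{gh}$ for all $g,h\in G$; it is strongly graded if $R_gR_h = R_{gh}$ for all $g,h \in G$ (where $R_gR_h$ denotes the set of finite sums of products). $R_H := \bigoplus_{h\in H} R_h$. For $X,Y\subseteq R$, $C_X(Y) := \{x\in X\mid xy=yx\text{ for all }y\in Y\}$. If $S$ is a subring of $R$, the extension $R/S$ is separable if there is an $R$-bimodule map $\delta: R\to R\otimes_S R$ with $\mu\circ\delta = \mathrm{id}_R$, where $\mu : R\otimes_S R\to R$ is the multiplication map $r \otimes r' \mapsto rr'$. For each $g\in G$ choose $n_g\in\mathbb{N} = \{1,2,3,\ldots\}$, $u_g^{(i)}\in R_g$ and $v_{g^{-1}}^{(i)}\in R_{g^{-1}}$ ($1\le i\le n_g$) with $1_R = \sum_{i=1}^{n_g} u_g^{(i)} v_{g^{-1}}^{(i)}$, and define $\gamma_g: R\to R$ by $\gamma_g(x)=\sum_{i=1}^{n_g} u_g^{(i)} x v_{g^{-1}}^{(i)}$. If $[G:H]$ is finite, choose a left transversal $T$ for $H$ in $G$ (a set of representatives of the cosets $gH$) and define the relative trace map $\mathrm{tr}_{G/H}: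 R\to R$ by $\mathrm{tr}_{G/H}(x) = \sum_{t\in T}\gamma_t(x)$. *)

theory Defs
  imports "HOL-Algebra.Free_Abelian_Groups" "HOL-Algebra.Generated_Groups"
    "HOL-Algebra.Left_Coset" "HOL-Algebra.Ideal_Product"
begin

section \<open>Rings graded by a group\<close>

locale graded_ring = group G + ring R
  for G :: "('g, 'm) monoid_scheme" (structure) and R :: "('r, 'k) ring_scheme" (structure) +
  fixes A :: "'g \<Rightarrow> 'r set"
  assumes component_subgroup: "g \<in> carrier G \<Longrightarrow> additive_subgroup (A g) R"
    and direct_sum: "x \<in> carrier R \<Longrightarrow>
      \<exists>!c. c \<in> (\<Pi>\<^sub>E g\<in>carrier G. A g) \<and> finite {g \<in> carrier G. c g \<noteq> \<zero>\<^bsub>R\<^esub>} \<and>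
        x = (\<Oplus>\<^bsub>R\<^esub>g\<in>{g \<in> carrier G. c g \<noteq> \<zero>\<^bsub>R\<^esub>}. c g)"
    and component_mult: "\<lbrakk>g \<in> carrier G; h \<in> carrier G; x \<in> A g; y \<in> A h\<rbrakk>
      \<Longrightarrow> x \<otimes>\<^bsub>R\<^esub> y \<in> A (g \<otimes>\<^bsub>G\<^esub> h)"

text \<open>Despite its name, \<^const>\<open>ideal_prod\<close> is, for arbitrary sets, the set of (nonempty)
  finite sums of products; for additive subgroups the empty sum adds nothing.\<close>

locale strongly_graded_ring = graded_ring +
  assumes strong: "\<lbrakk>g \<in> carrier G; h \<in> carrier G\<rbrakk>
      \<Longrightarrow> ideal_prod R (A g) (A h) = A (g \<otimes>\<^bsub>G\<^esub> h)"

definition graded_part :: "('r, 'k) ring_scheme \<Rightarrow> ('g \<Rightarrow> 'r set) \<Rightarrow> 'g set \<Rightarrow> 'r set"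
  where "graded_part R A H =
    {(\<Oplus>\<^bsub>R\<^esub>h\<in>F. c h) | F c. finite F \<and> F \<subseteq> H \<and> c \<in> (\<Pi> h\<in>F. A h)}"

definition centralizer_in :: "('r, 'k) ring_scheme \<Rightarrow> 'r set \<Rightarrow> 'r set \<Rightarrow> 'r set"
  where "centralizer_in R B C = {x \<in> B. \<forall>y\<in>C. x \<otimes>\<^bsub>R\<^esub> y = y \<otimes>\<^bsub>R\<^esub> x}"


section \<open>Relative trace maps\<close>

definition left_transversal :: "('g, 'm) monoid_scheme \<Rightarrow> 'g set \<Rightarrow> 'g set \<Rightarrow> bool"
  where "left_transversal G H T \<longleftrightarrow>
    T \<subseteq> carrier G \<and> (\<forall>C \<in> lcosets\<^bsub>G\<^esub> H. \<exists>!t. t \<in> T \<and> t \<in> C)"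

text \<open>The second family is indexed by the degree of its members, so the elements paired with
  \<open>u g i\<close> are the \<open>v (inv g) i\<close>.\<close>

definition grade_map :: "('g, 'm) monoid_scheme \<Rightarrow> ('r, 'k) ring_scheme \<Rightarrow> ('g \<Rightarrow> nat) \<Rightarrow>
    ('g \<Rightarrow> nat \<Rightarrow> 'r) \<Rightarrow> ('g \<Rightarrow> nat \<Rightarrow> 'r) \<Rightarrow> 'g \<Rightarrow> 'r \<Rightarrow> 'r"
  where "grade_map G R n u v g x =
    (\<Oplus>\<^bsub>R\<^esub>i\<in>{1..n g}. u g i \<otimes>\<^bsub>R\<^esub> x \<otimes>\<^bsub>R\<^esub> v (inv\<^bsub>G\<^esub> g) i)"

definition rel_trace :: "('g, 'm) monoid_scheme \<Rightarrow> ('r, 'k) ring_scheme \<Rightarrow> ('g \<Rightarrow> nat) \<Rightarrow>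
    ('g \<Rightarrow> nat \<Rightarrow> 'r) \<Rightarrow> ('g \<Rightarrow> nat \<Rightarrow> 'r) \<Rightarrow> 'g set \<Rightarrow> 'r \<Rightarrow> 'r"
  where "rel_trace G R n u v T x = (\<Oplus>\<^bsub>R\<^esub>t\<in>T. grade_map G R n u v t x)"


section \<open>The bimodule \<open>R \<otimes>\<^sub>S R\<close> and separable extensions\<close>

text \<open>The tensor product is the quotient of the free abelian group on pairs of ring elements by
  the subgroup generated by biadditivity and \<open>S\<close>-balancedness; its elements are cosets of formal
  integer combinations of pairs, and its group operation is written multiplicatively.\<close>

definition pair_group :: "('r, 'k) ring_scheme \<Rightarrow> (('r \<times> 'r) \<Rightarrow>\<^sub>0 int) monoid"
  where "pair_group R = free_Abelian_group (carrier R \<times> carrier R)"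

definition tensor_relators :: "('r, 'k) ring_scheme \<Rightarrow> 'r set \<Rightarrow> (('r \<times> 'r) \<Rightarrow>\<^sub>0 int) set"
  where "tensor_relators R S =
    {frag_of (x \<oplus>\<^bsub>R\<^esub> x', y) - frag_of (x, y) - frag_of (x', y) | x x' y.
        x \<in> carrier R \<and> x' \<in> carrier R \<and> y \<in> carrier R}
    \<union> {frag_of (x, y \<oplus>\<^bsub>R\<^esub> y') - frag_of (x, y) - frag_of (x, y') | x y y'.
        x \<in> carrier R \<and> y \<in> carrier R \<and> y' \<in> carrier R}
    \<union> {frag_of (x \<otimes>\<^bsub>R\<^esub> s, y) - frag_of (x, s \<otimes>\<^bsub>R\<^esub> y) | x s y.
        x \<in> carrier R \<and> s \<in> S \<and> y \<in> carrier R}"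

definition tensor_null :: "('r, 'k) ring_scheme \<Rightarrow> 'r set \<Rightarrow> (('r \<times> 'r) \<Rightarrow>\<^sub>0 int) set"
  where "tensor_null R S = generate (pair_group R) (tensor_relators R S)"

definition tensor_square :: "('r, 'k) ring_scheme \<Rightarrow> 'r set \<Rightarrow> (('r \<times> 'r) \<Rightarrow>\<^sub>0 int) set monoid"
  where "tensor_square R S = pair_group R Mod tensor_null R S"

definition tensor_class ::
    "('r, 'k) ring_scheme \<Rightarrow> 'r set \<Rightarrow> (('r \<times> 'r) \<Rightarrow>\<^sub>0 int) \<Rightarrow> (('r \<times> 'r) \<Rightarrow>\<^sub>0 int) set"
  where "tensor_class R S c = tensor_null R S #>\<^bsub>pair_group R\<^esub> c"

definition free_left :: "('r, 'k) ring_scheme \<Rightarrow> 'r \<Rightarrow> (('r \<times> 'r) \<Rightarrow>\<^sub>0 int) \<Rightarrow> (('r \<times> 'r) \<Rightarrow>\<^sub>0 int)"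
  where "free_left R r = frag_extend (\<lambda>(x, y). frag_of (r \<otimes>\<^bsub>R\<^esub> x, y))"

definition free_right :: "('r, 'k) ring_scheme \<Rightarrow> 'r \<Rightarrow> (('r \<times> 'r) \<Rightarrow>\<^sub>0 int) \<Rightarrow> (('r \<times> 'r) \<Rightarrow>\<^sub>0 int)"
  where "free_right R r = frag_extend (\<lambda>(x, y). frag_of (x, y \<otimes>\<^bsub>R\<^esub> r))"

definition free_mult :: "('r, 'k) ring_scheme \<Rightarrow> (('r \<times> 'r) \<Rightarrow>\<^sub>0 int) \<Rightarrow> 'r"
  where "free_mult R c =
    (\<Oplus>\<^bsub>R\<^esub>p\<in>Poly_Mapping.keys c. [Poly_Mapping.lookup c p] \<cdot>\<^bsub>R\<^esub> (fst p \<otimes>\<^bsub>R\<^esub> snd p))"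

definition tensor_left ::
    "('r, 'k) ring_scheme \<Rightarrow> 'r set \<Rightarrow> 'r \<Rightarrow> (('r \<times> 'r) \<Rightarrow>\<^sub>0 int) set \<Rightarrow> (('r \<times> 'r) \<Rightarrow>\<^sub>0 int) set"
  where "tensor_left R S r K = (\<Union>c\<in>K. tensor_class R S (free_left R r c))"

definition tensor_right ::
    "('r, 'k) ring_scheme \<Rightarrow> 'r set \<Rightarrow> (('r \<times> 'r) \<Rightarrow>\<^sub>0 int) set \<Rightarrow> 'r \<Rightarrow> (('r \<times> 'r) \<Rightarrow>\<^sub>0 int) set"
  where "tensor_right R S K r = (\<Union>c\<in>K. tensor_class R S (free_right R r c))"

definition tensor_mult :: "('r, 'k) ring_scheme \<Rightarrow> (('r \<times> 'r) \<Rightarrow>\<^sub>0 int) set \<Rightarrow> 'r"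
  where "tensor_mult R K = the_elem (free_mult R ` K)"

definition separable_extension :: "('r, 'k) ring_scheme \<Rightarrow> 'r set \<Rightarrow> bool"
  where "separable_extension R S \<longleftrightarrow>
    (\<exists>\<delta> \<in> hom (add_monoid R) (tensor_square R S).
      (\<forall>r \<in> carrier R. \<forall>x \<in> carrier R.
        \<delta> (r \<otimes>\<^bsub>R\<^esub> x) = tensor_left R S r (\<delta> x) \<and>
        \<delta> (x \<otimes>\<^bsub>R\<^esub> r) = tensor_right R S (\<delta> x) r) \<and>
      (\<forall>x \<in> carrier R. tensor_mult R (\<delta> x) = x))"

text \<open>The two actions and the multiplication map do not depend on the choice of
  representatives.\<close>

context ring
begin

lemma group_pair_group: "group (pair_group R)" "comm_group (pair_group R)"
  unfolding pair_group_def by (simp_all add: abelian_free_Abelian_group)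

lemma carrier_pair_group [simp]:
  "c \<in> carrier (pair_group R) \<longleftrightarrow> Poly_Mapping.keys c \<subseteq> carrier R \<times> carrier R"
  unfolding pair_group_def by simp

lemma mult_pair_group [simp]: "x \<otimes>\<^bsub>pair_group R\<^esub> y = x + y"
  unfolding pair_group_def by simp

lemma free_mult_hom:
  "free_mult R \<in> hom (pair_group R) (add_monoid R)"
  "\<lbrakk>x \<in> carrier R; y \<in> carrier R\<rbrakk> \<Longrightarrow> free_mult R (frag_of (x, y)) = x \<otimes> y"
proof -
  let ?P = "carrier R \<times> carrier R"
  obtain h where h: "h \<in> hom (pair_group R) (add_monoid R)"
    and h1: "\<And>p. p \<in> ?P \<Longrightarrow> h (frag_of p) = fst p \<otimes> snd p"
  proof (rule add.free_Abelian_group_universal[of "\<lambda>p. fst p \<otimes> snd p" ?P])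
    show "(\<lambda>p. fst p \<otimes> snd p) ` ?P \<subseteq> carrier R" by auto
  qed (use that in \<open>auto simp: pair_group_def\<close>)
  interpret h: group_hom "pair_group R" "add_monoid R" h
    using h group_pair_group(1) a_group by (simp add: group_hom_def group_hom_axioms_def)
  have add: "h (a + b) = h a \<oplus> h b"
    if "Poly_Mapping.keys a \<subseteq> ?P" "Poly_Mapping.keys b \<subseteq> ?P" for a b
    using h.hom_mult[of a b] that by simp
  have cmul: "h (frag_cmul k (frag_of p)) = [k] \<cdot> (fst p \<otimes> snd p)" if "p \<in> ?P" for p k
  proof -
    have "h (frag_of p [^]\<^bsub>pair_group R\<^esub> k) = [k] \<cdot> h (frag_of p)"
      using h.hom_int_pow[of "frag_of p" k] that by (simp add: add_pow_def)
    then show ?thesis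
      using that h1 by (simp add: pair_group_def)
  qed
  have sum: "Poly_Mapping.keys (\<Sum>p\<in>F. frag_cmul (k p) (frag_of p)) \<subseteq> ?P \<and>
      h (\<Sum>p\<in>F. frag_cmul (k p) (frag_of p)) = (\<Oplus>p\<in>F. [k p] \<cdot> (fst p \<otimes> snd p))"
    if "finite F" "F \<subseteq> ?P" for F and k :: "_ \<Rightarrow> int"
    using that
  proof (induction F rule: finite_induct)
    case empty
    then show ?case using h.hom_one by (simp add: pair_group_def)
  next
    case (insert p F)
    have keys: "Poly_Mapping.keys (frag_cmul (k p) (frag_of p)) \<subseteq> ?P"
      using insert.prems by auto
    have fn: "(\<lambda>p. [k p] \<cdot> (fst p \<otimes> snd p)) \<in> F \<rightarrow> carrier R"
      using insert.prems by (auto intro!: add.int_pow_closed)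
    have p: "[k p] \<cdot> (fst p \<otimes> snd p) \<in> carrier R"
      using insert.prems by (auto intro!: add.int_pow_closed)
    show ?case
      using insert keys fn p add[OF keys] cmul[of p]
      by (auto simp: add.finprod_insert dest!: subsetD[OF keys_add])
  qed
  have eq: "free_mult R c = h c" if "Poly_Mapping.keys c \<subseteq> ?P" for c
    using sum[of "Poly_Mapping.keys c" "Poly_Mapping.lookup c"] that
    unfolding free_mult_def
    by (metis frag_expansion frag_extend_def finite_keys)
  show "free_mult R \<in> hom (pair_group R) (add_monoid R)"
    using h eq unfolding hom_def by (auto simp: keys_add[THEN subset_trans])
  show "free_mult R (frag_of (x, y)) = x \<otimes> y" if "x \<in> carrier R" "y \<in> carrier R"
    using eq[of "frag_of (x, y)"] h1[of "(x, y)"] that by simp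
qed

lemma tensor_relators_closed:
  assumes "S \<subseteq> carrier R"
  shows "tensor_relators R S \<subseteq> carrier (pair_group R)"
proof
  fix c assume "c \<in> tensor_relators R S"
  then show "c \<in> carrier (pair_group R)"
    using assms unfolding tensor_relators_def
    by (auto dest!: subsetD[OF keys_diff])
qed

lemma tensor_null_normal:
  assumes "S \<subseteq> carrier R"
  shows "tensor_null R S \<lhd> pair_group R"
  using comm_group.subgroup_imp_normal[OF group_pair_group(2)]
    group.generate_is_subgroup[OF group_pair_group(1) tensor_relators_closed[OF assms]]
  by (simp add: tensor_null_def)

lemma tensor_class_closed:
  assumes "c \<in> carrier (pair_group R)"
  shows "tensor_class R S c \<in> carrier (tensor_square R S)"
  using assms unfolding tensor_square_def tensor_class_def carrier_FactGroup by blast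

lemma hom_tensor_null:
  assumes S: "S \<subseteq> carrier R" and f: "f \<in> hom (pair_group R) K" and K: "group K"
    and L: "subgroup L K" and rel: "f ` tensor_relators R S \<subseteq> L" and c: "c \<in> tensor_null R S"
  shows "f c \<in> L"
proof -
  interpret f: group_hom "pair_group R" K f
    using f K group_pair_group(1) by (simp add: group_hom_def group_hom_axioms_def)
  have "f ` tensor_null R S = generate K (f ` tensor_relators R S)"
    unfolding tensor_null_def using f.generate_img[OF tensor_relators_closed[OF S]] by simp
  also have "\<dots> \<subseteq> L"
    using group.generate_subgroup_incl[OF K rel L] .
  finally show ?thesis using c by blast
qed

lemma tensor_class_eqI:
  assumes S: "S \<subseteq> carrier R" and f: "f \<in> hom (pair_group R) (pair_group R)"
    and rel: "f ` tensor_relators R S \<subseteq> tensor_null R S" and c: "c \<in> carrier (pair_group R)"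
  shows "(\<Union>d\<in>tensor_class R S c. tensor_class R S (f d)) = tensor_class R S (f c)"
proof -
  interpret N: normal "tensor_null R S" "pair_group R"
    using tensor_null_normal[OF S] .
  have eq: "tensor_class R S (f d) = tensor_class R S (f c)" if d: "d \<in> tensor_class R S c" for d
  proof -
    obtain m where m: "m \<in> tensor_null R S" "d = m + c"
      using d unfolding tensor_class_def r_coset_def by auto
    have fm: "f m \<in> tensor_null R S"
      using hom_tensor_null[OF S f group_pair_group(1) N.subgroup_axioms rel m(1)] .
    have "f d = f m \<otimes>\<^bsub>pair_group R\<^esub> f c"
      using hom_mult[OF f, of m c] N.mem_carrier[OF m(1)] c m(2) by simp
    then have "f d \<in> tensor_class R S (f c)"
      using fm unfolding tensor_class_def r_coset_def by blast
    then show ?thesis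
      unfolding tensor_class_def
      using N.repr_independence[OF _ hom_in_carrier[OF f c] N.subgroup_axioms] by metis
  qed
  have "c \<in> tensor_class R S c"
    unfolding tensor_class_def using N.rcos_self[OF c N.subgroup_axioms] .
  then show ?thesis using eq by blast
qed

lemma free_left_hom:
  assumes r: "r \<in> carrier R"
  shows "free_left R r \<in> hom (pair_group R) (pair_group R)"
proof (rule homI)
  fix c assume "c \<in> carrier (pair_group R)"
  then show "free_left R r c \<in> carrier (pair_group R)"
    unfolding free_left_def using r by (auto dest!: subsetD[OF keys_frag_extend])
qed (simp add: free_left_def frag_extend_add)

lemma free_right_hom:
  assumes r: "r \<in> carrier R"
  shows "free_right R r \<in> hom (pair_group R) (pair_group R)"
proof (rule homI)
  fix c assume "c \<in> carrier (pair_group R)"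
  then show "free_right R r c \<in> carrier (pair_group R)"
    unfolding free_right_def using r by (auto dest!: subsetD[OF keys_frag_extend])
qed (simp add: free_right_def frag_extend_add)

lemma tensor_left_class:
  assumes S: "S \<subseteq> carrier R" and r: "r \<in> carrier R" and c: "c \<in> carrier (pair_group R)"
  shows "tensor_left R S r (tensor_class R S c) = tensor_class R S (free_left R r c)"
proof -
  have "free_left R r d \<in> tensor_relators R S" if d: "d \<in> tensor_relators R S" for d
  proof -
    from d consider
        x x' y where "d = frag_of (x \<oplus> x', y) - frag_of (x, y) - frag_of (x', y)"
          "x \<in> carrier R" "x' \<in> carrier R" "y \<in> carrier R"
      | x y y' where "d = frag_of (x, y \<oplus> y') - frag_of (x, y) - frag_of (x, y')"
          "x \<in> carrier R" "y \<in> carrier R" "y' \<in> carrier R"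
      | x s y where "d = frag_of (x \<otimes> s, y) - frag_of (x, s \<otimes> y)"
          "x \<in> carrier R" "s \<in> S" "y \<in> carrier R"
      unfolding tensor_relators_def by blast
    then show ?thesis
    proof cases
      case 1
      then have "free_left R r d = frag_of (r \<otimes> x \<oplus> r \<otimes> x', y) - frag_of (r \<otimes> x, y)
          - frag_of (r \<otimes> x', y)"
        using r by (simp add: free_left_def frag_extend_diff r_distr)
      then show ?thesis
        unfolding tensor_relators_def using 1 r m_closed by blast
    next
      case 2
      then have "free_left R r d = frag_of (r \<otimes> x, y \<oplus> y') - frag_of (r \<otimes> x, y)
          - frag_of (r \<otimes> x, y')"
        by (simp add: free_left_def frag_extend_diff)
      then show ?thesis
        unfolding tensor_relators_def using 2 r m_closed by blast
    next
      case 3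
      then have "free_left R r d = frag_of (r \<otimes> x \<otimes> s, y) - frag_of (r \<otimes> x, s \<otimes> y)"
        using r S by (simp add: free_left_def frag_extend_diff m_assoc subset_iff)
      then show ?thesis
        unfolding tensor_relators_def using 3 r m_closed by blast
    qed
  qed
  then show ?thesis
    unfolding tensor_left_def
    by (intro tensor_class_eqI[OF S free_left_hom[OF r] _ c])
      (auto simp: tensor_null_def intro: generate.incl)
qed

lemma tensor_right_class:
  assumes S: "S \<subseteq> carrier R" and r: "r \<in> carrier R" and c: "c \<in> carrier (pair_group R)"
  shows "tensor_right R S (tensor_class R S c) r = tensor_class R S (free_right R r c)"
proof -
  have "free_right R r d \<in> tensor_relators R S" if d: "d \<in> tensor_relators R S" for d
  proof -
    from d consider
        x x' y where "d = frag_of (x \<oplus> x', y) - frag_of (x, y) - frag_of (x', y)"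
          "x \<in> carrier R" "x' \<in> carrier R" "y \<in> carrier R"
      | x y y' where "d = frag_of (x, y \<oplus> y') - frag_of (x, y) - frag_of (x, y')"
          "x \<in> carrier R" "y \<in> carrier R" "y' \<in> carrier R"
      | x s y where "d = frag_of (x \<otimes> s, y) - frag_of (x, s \<otimes> y)"
          "x \<in> carrier R" "s \<in> S" "y \<in> carrier R"
      unfolding tensor_relators_def by blast
    then show ?thesis
    proof cases
      case 1
      then have "free_right R r d = frag_of (x \<oplus> x', y \<otimes> r) - frag_of (x, y \<otimes> r)
          - frag_of (x', y \<otimes> r)"
        by (simp add: free_right_def frag_extend_diff)
      then show ?thesis
        unfolding tensor_relators_def using 1 r m_closed by blast
    next
      case 2
      then have "free_right R r d = frag_of (x, y \<otimes> r \<oplus> y' \<otimes> r) - frag_of (x, y \<otimes> r)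
          - frag_of (x, y' \<otimes> r)"
        using r by (simp add: free_right_def frag_extend_diff l_distr)
      then show ?thesis
        unfolding tensor_relators_def using 2 r m_closed by blast
    next
      case 3
      then have "free_right R r d = frag_of (x \<otimes> s, y \<otimes> r) - frag_of (x, s \<otimes> (y \<otimes> r))"
        using r S by (simp add: free_right_def frag_extend_diff m_assoc subset_iff)
      then show ?thesis
        unfolding tensor_relators_def using 3 r m_closed by blast
    qed
  qed
  then show ?thesis
    unfolding tensor_right_def
    by (intro tensor_class_eqI[OF S free_right_hom[OF r] _ c])
      (auto simp: tensor_null_def intro: generate.incl)
qed

lemma tensor_mult_class:
  assumes S: "S \<subseteq> carrier R" and c: "c \<in> carrier (pair_group R)"
  shows "tensor_mult R (tensor_class R S c) = free_mult R c"
proof -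
  interpret N: normal "tensor_null R S" "pair_group R"
    using tensor_null_normal[OF S] .
  interpret m: group_hom "pair_group R" "add_monoid R" "free_mult R"
    using free_mult_hom(1) group_pair_group(1) a_group
    by (simp add: group_hom_def group_hom_axioms_def)
  have diff: "free_mult R (a - b) = free_mult R a \<ominus> free_mult R b"
    if "a \<in> carrier (pair_group R)" "b \<in> carrier (pair_group R)" for a b
    using m.hom_mult[of a "- b"] m.hom_inv[of b] that
    by (simp add: pair_group_def a_minus_def a_inv_def)
  have rel: "free_mult R d = \<zero>" if d: "d \<in> tensor_relators R S" for d
  proof -
    from d consider
        x x' y where "d = frag_of (x \<oplus> x', y) - frag_of (x, y) - frag_of (x', y)"
          "x \<in> carrier R" "x' \<in> carrier R" "y \<in> carrier R"
      | x y y' where "d = frag_of (x, y \<oplus> y') - frag_of (x, y) - frag_of (x, y')"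
          "x \<in> carrier R" "y \<in> carrier R" "y' \<in> carrier R"
      | x s y where "d = frag_of (x \<otimes> s, y) - frag_of (x, s \<otimes> y)"
          "x \<in> carrier R" "s \<in> carrier R" "y \<in> carrier R"
      unfolding tensor_relators_def using S by blast
    then show ?thesis
    proof cases
      case 1
      have "Poly_Mapping.keys (frag_of (x \<oplus> x', y) - frag_of (x, y)) \<subseteq> carrier R \<times> carrier R"
        using 1 by (auto dest!: subsetD[OF keys_diff])
      then show ?thesis using 1 by (simp add: diff free_mult_hom(2)) algebra
    next
      case 2
      have "Poly_Mapping.keys (frag_of (x, y \<oplus> y') - frag_of (x, y)) \<subseteq> carrier R \<times> carrier R"
        using 2 by (auto dest!: subsetD[OF keys_diff])
      then show ?thesis using 2 by (simp add: diff free_mult_hom(2)) algebra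
    next
      case 3
      then show ?thesis by (simp add: diff free_mult_hom(2) m_assoc r_neg a_minus_def)
    qed
  qed
  have null: "free_mult R d = \<zero>" if "d \<in> tensor_null R S" for d
    using hom_tensor_null[OF S free_mult_hom(1) a_group add.triv_subgroup _ that] rel by auto
  have "free_mult R d = free_mult R c" if d: "d \<in> tensor_class R S c" for d
  proof -
    obtain k where k: "k \<in> tensor_null R S" "d = k + c"
      using d unfolding tensor_class_def r_coset_def by auto
    then show ?thesis
      using m.hom_mult[of k c] N.mem_carrier[OF k(1)] c null[OF k(1)] m.hom_closed[OF c] by simp
  qed
  moreover have "c \<in> tensor_class R S c"
    unfolding tensor_class_def using N.rcos_self[OF c N.subgroup_axioms] .
  ultimately have "free_mult R ` tensor_class R S c = {free_mult R c}"
    by blast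
  then show ?thesis unfolding tensor_mult_def by simp
qed

end

end

theory Submission
  imports Defs
begin

text \<open>Separability amounts to an element \<open>c\<close> of \<open>R \<otimes>\<^sub>S R\<close>, where \<open>S = R\<^sub>H\<close>, with \<open>\<mu>(c) = 1\<close> and
  \<open>x c = c x\<close> for all \<open>x\<close>.

  Given such a \<open>c\<close>, project the first tensor factor onto the degrees in a left coset \<open>D\<close> of \<open>H\<close> and
  multiply, to get \<open>a\<^sub>D \<in> R\<close>. Only finitely many \<open>a\<^sub>D\<close> are nonzero, they sum to \<open>1\<close>, and
  \<open>x a\<^sub>H = a\<^sub>g\<^sub>H x\<close> for \<open>x\<close> of degree \<open>g\<close>, that is, \<open>a\<^sub>g\<^sub>H = \<gamma>\<^sub>g(a\<^sub>H)\<close>. If one \<open>a\<^sub>D\<close> vanishes then so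
  does \<open>a\<^sub>H\<close> and hence all of them, which is impossible, so the index is finite; the component of
  \<open>a\<^sub>H\<close> in degree \<open>e\<close> has trace \<open>1\<close>.

  Conversely \<open>c = \<Sum>\<^sub>t \<Sum>\<^sub>i u\<^sub>t\<^sub>i r \<otimes> v\<^sub>t\<^sub>i\<close> works: for \<open>x\<close> of degree \<open>g\<close> and \<open>g t H = t' H\<close>, inserting
  \<open>1 = \<Sum>\<^sub>j u\<^sub>t\<^sub>'\<^sub>j v\<^sub>t\<^sub>'\<^sub>j\<close> on the left lets \<open>v\<^sub>t\<^sub>'\<^sub>j x u\<^sub>t\<^sub>i \<in> S\<close> pass through \<open>r\<close> and the tensor sign.\<close>

section \<open>Separability elements\<close>

context ring
begin

section \<open>Finite sums, and homomorphisms out of the free abelian group on pairs\<close>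

lemma finsum_diff:
  assumes "f \<in> I \<rightarrow> carrier R" "g \<in> I \<rightarrow> carrier R"
  shows "(\<Oplus>i\<in>I. f i \<ominus> g i) = (\<Oplus>i\<in>I. f i) \<ominus> (\<Oplus>i\<in>I. g i)"
proof -
  have fg: "f i \<in> carrier R" "g i \<in> carrier R" if "i \<in> I" for i using assms that by auto
  let ?d = "\<Oplus>i\<in>I. f i \<ominus> g i" and ?f = "\<Oplus>i\<in>I. f i" and ?g = "\<Oplus>i\<in>I. g i"
  have "?d \<oplus> ?g = (\<Oplus>i\<in>I. (f i \<ominus> g i) \<oplus> g i)"
    using fg by (subst finsum_addf) auto
  also have "\<dots> = ?f"
    by (rule finsum_cong') (use fg in \<open>auto simp: a_minus_def a_assoc l_neg\<close>)
  finally have sum: "?d \<oplus> ?g = ?f" .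
  have "?d \<in> carrier R" "?g \<in> carrier R" using fg by (auto intro!: finsum_closed)
  then show ?thesis unfolding sum[symmetric] by (simp add: a_minus_def a_assoc r_neg)
qed

text \<open>Pure pairs generate the free abelian group, and closure under differences covers sums
  and negatives at once. Identities between additive maps are therefore checked on pure pairs
  only.\<close>

lemma pair_group_induct [consumes 1, case_names zero pure diff]:
  assumes c: "c \<in> carrier (pair_group R)" and zero: "P 0"
    and pure: "\<And>x y. \<lbrakk>x \<in> carrier R; y \<in> carrier R\<rbrakk> \<Longrightarrow> P (frag_of (x, y))"
    and diff: "\<And>a b. \<lbrakk>a \<in> carrier (pair_group R); b \<in> carrier (pair_group R); P a; P b\<rbrakk> \<Longrightarrow> P (a - b)"
  shows "P c"
proof -
  have "Poly_Mapping.keys c \<subseteq> carrier R \<times> carrier R" using c by simp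
  then have "c \<in> carrier (pair_group R) \<and> P c"
  proof (induction c rule: frag_induction)
    case (diff a b)
    then show ?case
      using assms(4)[of a b] subset_trans[OF keys_diff[of a b]] by auto
  qed (use zero pure in auto)
  then show ?thesis by simp
qed

lemma zero_pair_group: "\<one>\<^bsub>pair_group R\<^esub> = 0"
  by (simp add: pair_group_def)

lemma inv_pair_group: "c \<in> carrier (pair_group R) \<Longrightarrow> inv\<^bsub>pair_group R\<^esub> c = - c"
  by (simp add: pair_group_def)

lemma pair_group_hom_zero:
  assumes "f \<in> hom (pair_group R) (add_monoid R)" shows "f 0 = \<zero>"
  using hom_one[OF assms group_pair_group(1) a_group] by (simp add: zero_pair_group)

lemma pair_group_hom_diff:
  assumes f: "f \<in> hom (pair_group R) (add_monoid R)"
    and a: "a \<in> carrier (pair_group R)" and b: "b \<in> carrier (pair_group R)"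
  shows "f (a - b) = f a \<ominus> f b"
proof -
  interpret f: group_hom "pair_group R" "add_monoid R" f
    using f group_pair_group(1) a_group by (simp add: group_hom_def group_hom_axioms_def)
  have "- b \<in> carrier (pair_group R)" using b by simp
  then show ?thesis
    using f.hom_mult[OF a, of "- b"] f.hom_inv[OF b] b
    by (simp add: inv_pair_group a_minus_def a_inv_def)
qed

lemma pair_group_sum_closed:
  "(\<And>i. i \<in> I \<Longrightarrow> f i \<in> carrier (pair_group R)) \<Longrightarrow> sum f I \<in> carrier (pair_group R)"
proof (induction I rule: infinite_finite_induct)
  case (insert i I)
  then have "f i \<in> carrier (pair_group R)" "sum f I \<in> carrier (pair_group R)" by auto
  then show ?case
    using group.is_monoid[OF group_pair_group(1), THEN monoid.m_closed] insert.hyps by fastforce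
qed auto

lemma pair_group_hom_sum:
  assumes f: "f \<in> hom (pair_group R) (add_monoid R)" and I: "finite I"
    and c: "\<And>i. i \<in> I \<Longrightarrow> c i \<in> carrier (pair_group R)"
  shows "f (sum c I) = (\<Oplus>i\<in>I. f (c i))"
  using I c
proof (induction I)
  case empty
  show ?case by (simp add: pair_group_hom_zero[OF f])
next
  case (insert i I)
  have fc: "f (c k) \<in> carrier R" if "k \<in> insert i I" for k
    using hom_in_carrier[OF f insert.prems[OF that]] by simp
  have "f (c i + sum c I) = f (c i) \<oplus> f (sum c I)"
    using hom_mult[OF f, of "c i" "sum c I"] insert.prems pair_group_sum_closed[of I c] by simp
  then show ?case using insert fc by (simp add: finsum_insert)
qed

section \<open>Left and right multiplication on formal combinations\<close>

lemma free_left_closed: "\<lbrakk>r \<in> carrier R; c \<in> carrier (pair_group R)\<rbrakk> \<Longrightarrow> free_left R r c \<in> carrier (pair_group R)"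
  by (rule hom_in_carrier[OF free_left_hom])

lemma free_right_closed: "\<lbrakk>r \<in> carrier R; c \<in> carrier (pair_group R)\<rbrakk> \<Longrightarrow> free_right R r c \<in> carrier (pair_group R)"
  by (rule hom_in_carrier[OF free_right_hom])

lemma free_left_simps:
  "free_left R r 0 = 0" "free_left R r (frag_of (x, y)) = frag_of (r \<otimes> x, y)"
  "free_left R r (a - b) = free_left R r a - free_left R r b"
  by (simp_all add: free_left_def frag_extend_diff)

lemma free_right_simps:
  "free_right R r 0 = 0" "free_right R r (frag_of (x, y)) = frag_of (x, y \<otimes> r)"
  "free_right R r (a - b) = free_right R r a - free_right R r b"
  by (simp_all add: free_right_def frag_extend_diff)

lemma free_left_sum: "finite I \<Longrightarrow> free_left R r (sum c I) = (\<Sum>i\<in>I. free_left R r (c i))"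
  by (simp add: free_left_def frag_extend_sum comp_def)

lemma free_right_sum: "finite I \<Longrightarrow> free_right R r (sum c I) = (\<Sum>i\<in>I. free_right R r (c i))"
  by (simp add: free_right_def frag_extend_sum comp_def)

text \<open>Associativity settles the pure pairs. Together with
  \<open>free_mult R c = \<one>\<close> it shows that the left multiple of \<open>c\<close> by
  \<open>x\<close> multiplies out to \<open>x\<close>.\<close>

lemma free_mult_left:
  assumes r: "r \<in> carrier R" and c: "c \<in> carrier (pair_group R)"
  shows "free_mult R (free_left R r c) = r \<otimes> free_mult R c"
  using c
proof (induction rule: pair_group_induct)
  case zero
  then show ?case using r by (simp add: free_left_simps pair_group_hom_zero[OF free_mult_hom(1)])
next
  case (pure x y)
  then show ?case using r by (simp add: free_left_simps free_mult_hom(2) m_assoc)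
next
  case (diff a b)
  have "free_mult R a \<in> carrier R" "free_mult R b \<in> carrier R"
    using diff(1,2) hom_in_carrier[OF free_mult_hom(1)] by auto
  then show ?case
    using diff r
    by (simp only: free_left_simps pair_group_hom_diff[OF free_mult_hom(1)] free_left_closed
        a_minus_def r_distr r_minus a_inv_closed)
qed

lemma free_left_left:
  assumes "r \<in> carrier R" "s \<in> carrier R" and c: "c \<in> carrier (pair_group R)"
  shows "free_left R r (free_left R s c) = free_left R (r \<otimes> s) c"
  using c by (induction rule: pair_group_induct) (simp_all add: free_left_simps assms m_assoc)

lemma free_left_right:
  assumes "r \<in> carrier R" "s \<in> carrier R" and c: "c \<in> carrier (pair_group R)"
  shows "free_left R r (free_right R s c) = free_right R s (free_left R r c)"
  using c by (induction rule: pair_group_induct) (simp_all add: free_left_simps free_right_simps)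

section \<open>Congruence of formal combinations modulo the tensor relators\<close>

context
  fixes S assumes S: "S \<subseteq> carrier R"
begin

lemma tensor_null_subgroup: "subgroup (tensor_null R S) (pair_group R)"
  using normal_imp_subgroup[OF tensor_null_normal[OF S]] .

lemma tensor_null_carrier: "c \<in> tensor_null R S \<Longrightarrow> c \<in> carrier (pair_group R)"
  by (rule subgroup.mem_carrier[OF tensor_null_subgroup])

lemma tensor_null_0: "0 \<in> tensor_null R S"
  using subgroup.one_closed[OF tensor_null_subgroup] by (simp only: zero_pair_group)

lemma tensor_null_add: "\<lbrakk>c \<in> tensor_null R S; d \<in> tensor_null R S\<rbrakk> \<Longrightarrow> c + d \<in> tensor_null R S"
  using subgroup.m_closed[OF tensor_null_subgroup, of c d] by simp

lemma tensor_null_uminus: "c \<in> tensor_null R S \<Longrightarrow> - c \<in> tensor_null R S"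
  using subgroup.m_inv_closed[OF tensor_null_subgroup, of c]
  by (simp only: inv_pair_group tensor_null_carrier)

lemma tensor_null_diff: "\<lbrakk>c \<in> tensor_null R S; d \<in> tensor_null R S\<rbrakk> \<Longrightarrow> c - d \<in> tensor_null R S"
  using tensor_null_add[of c "- d"] tensor_null_uminus[of d] by simp

lemma tensor_null_sum: "(\<And>i. i \<in> I \<Longrightarrow> f i \<in> tensor_null R S) \<Longrightarrow> sum f I \<in> tensor_null R S"
  by (induction I rule: infinite_finite_induct) (simp_all add: tensor_null_0 tensor_null_add)

lemma tensor_null_cong_sum:
  assumes "\<And>i. i \<in> I \<Longrightarrow> f i - g i \<in> tensor_null R S"
  shows "sum f I - sum g I \<in> tensor_null R S"
  using tensor_null_sum[of I "\<lambda>i. f i - g i"] assms by (simp add: sum_subtractf)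

lemma tensor_null_cong_trans:
  "\<lbrakk>a - b \<in> tensor_null R S; b - c \<in> tensor_null R S\<rbrakk> \<Longrightarrow> a - c \<in> tensor_null R S"
  using tensor_null_add[of "a - b" "b - c"] by simp

lemma tensor_null_cong_sym: "a - b \<in> tensor_null R S \<Longrightarrow> b - a \<in> tensor_null R S"
  using tensor_null_uminus[of "a - b"] by simp

lemma tensor_null_relators:
  "\<lbrakk>x \<in> carrier R; x' \<in> carrier R; y \<in> carrier R\<rbrakk>
    \<Longrightarrow> frag_of (x \<oplus> x', y) - frag_of (x, y) - frag_of (x', y) \<in> tensor_null R S"
  "\<lbrakk>x \<in> carrier R; y \<in> carrier R; y' \<in> carrier R\<rbrakk>
    \<Longrightarrow> frag_of (x, y \<oplus> y') - frag_of (x, y) - frag_of (x, y') \<in> tensor_null R S"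
  "\<lbrakk>x \<in> carrier R; s \<in> S; y \<in> carrier R\<rbrakk>
    \<Longrightarrow> frag_of (x \<otimes> s, y) - frag_of (x, s \<otimes> y) \<in> tensor_null R S"
  unfolding tensor_null_def tensor_relators_def by (rule generate.incl, blast)+

text \<open>Each induction step adds one left additivity relator to the congruence already
  obtained.\<close>

lemma tensor_null_finsum_left:
  assumes "finite I" "\<And>i. i \<in> I \<Longrightarrow> f i \<in> carrier R" and y: "y \<in> carrier R"
  shows "frag_of (\<Oplus>i\<in>I. f i, y) - (\<Sum>i\<in>I. frag_of (f i, y)) \<in> tensor_null R S"
  using assms(1,2)
proof (induction I)
  case empty
  \<comment> \<open>The generator \<open>frag_of (\<zero>, y)\<close> is not zero in the free group.
    The additivity relator with both summands zero equals its negative.\<close>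
  show ?case using tensor_null_uminus[OF tensor_null_relators(1)[of \<zero> \<zero> y]] y by simp
next
  case (insert i I)
  let ?s = "\<Oplus>i\<in>I. f i"
  have f: "f i \<in> carrier R" "f \<in> I \<rightarrow> carrier R" "?s \<in> carrier R"
    using insert.prems by (auto intro: finsum_closed)
  have "(frag_of (f i \<oplus> ?s, y) - frag_of (f i, y) - frag_of (?s, y))
      + (frag_of (?s, y) - (\<Sum>i\<in>I. frag_of (f i, y))) \<in> tensor_null R S"
    using insert f y by (intro tensor_null_add tensor_null_relators) auto
  then show ?case
    using insert.hyps f by (simp add: finsum_insert algebra_simps)
qed

lemma tensor_null_finsum_right:
  assumes "finite I" "\<And>i. i \<in> I \<Longrightarrow> f i \<in> carrier R" and x: "x \<in> carrier R"
  shows "frag_of (x, \<Oplus>i\<in>I. f i) - (\<Sum>i\<in>I. frag_of (x, f i)) \<in> tensor_null R S"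
  using assms(1,2)
proof (induction I)
  case empty
  show ?case using tensor_null_uminus[OF tensor_null_relators(2)[of x \<zero> \<zero>]] x by simp
next
  case (insert i I)
  let ?s = "\<Oplus>i\<in>I. f i"
  have f: "f i \<in> carrier R" "f \<in> I \<rightarrow> carrier R" "?s \<in> carrier R"
    using insert.prems by (auto intro: finsum_closed)
  have "(frag_of (x, f i \<oplus> ?s) - frag_of (x, f i) - frag_of (x, ?s))
      + (frag_of (x, ?s) - (\<Sum>i\<in>I. frag_of (x, f i))) \<in> tensor_null R S"
    using insert f x by (intro tensor_null_add tensor_null_relators) auto
  then show ?case
    using insert.hyps f by (simp add: finsum_insert algebra_simps)
qed

text \<open>The action is strictly additive in \<open>c\<close>, but in the scalar only up to
  relators: on a pure pair the discrepancy is a biadditivity relator. This yields additivity of the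
  bimodule map built from \<open>c\<close>.\<close>

lemma free_left_add:
  assumes r: "r \<in> carrier R" "s \<in> carrier R" and c: "c \<in> carrier (pair_group R)"
  shows "free_left R (r \<oplus> s) c - (free_left R r c + free_left R s c) \<in> tensor_null R S"
  using c
proof (induction rule: pair_group_induct)
  case zero
  then show ?case by (simp add: free_left_simps tensor_null_0)
next
  case (pure x y)
  then show ?case
    using tensor_null_relators(1)[of "r \<otimes> x" "s \<otimes> x" y] r
    by (simp add: free_left_simps l_distr algebra_simps)
next
  case (diff a b)
  then show ?case
    using tensor_null_diff[OF diff(3,4)] by (simp add: free_left_simps algebra_simps)
qed

lemma free_right_add:
  assumes r: "r \<in> carrier R" "s \<in> carrier R" and c: "c \<in> carrier (pair_group R)"
  shows "free_right R (r \<oplus> s) c - (free_right R r c + free_right R s c) \<in> tensor_null R S"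
  using c
proof (induction rule: pair_group_induct)
  case zero
  then show ?case by (simp add: free_right_simps tensor_null_0)
next
  case (pure x y)
  then show ?case
    using tensor_null_relators(2)[of x "y \<otimes> r" "y \<otimes> s"] r
    by (simp add: free_right_simps r_distr algebra_simps)
next
  case (diff a b)
  then show ?case
    using tensor_null_diff[OF diff(3,4)] by (simp add: free_right_simps algebra_simps)
qed

lemma tensor_class_eq_iff:
  assumes c: "c \<in> carrier (pair_group R)" and d: "d \<in> carrier (pair_group R)"
  shows "tensor_class R S c = tensor_class R S d \<longleftrightarrow> c - d \<in> tensor_null R S"
proof
  assume "tensor_class R S c = tensor_class R S d"
  then have "c \<in> tensor_class R S d"
    using group.rcos_self[OF group_pair_group(1) c tensor_null_subgroup]
    by (simp add: tensor_class_def)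
  then show "c - d \<in> tensor_null R S"
    unfolding tensor_class_def r_coset_def by auto
next
  assume "c - d \<in> tensor_null R S"
  then have "c \<in> tensor_class R S d"
    unfolding tensor_class_def r_coset_def by (auto intro!: bexI[of _ "c - d"])
  then show "tensor_class R S c = tensor_class R S d"
    unfolding tensor_class_def
    using group.repr_independence[OF group_pair_group(1) _ d tensor_null_subgroup] by simp
qed

lemma tensor_class_mult:
  assumes "c \<in> carrier (pair_group R)" "d \<in> carrier (pair_group R)"
  shows "tensor_class R S c \<otimes>\<^bsub>tensor_square R S\<^esub> tensor_class R S d = tensor_class R S (c + d)"
  using normal.rcos_sum[OF tensor_null_normal[OF S] assms]
  by (simp add: tensor_class_def tensor_square_def FactGroup_def)

text \<open>The element \<open>c\<close> below represents \<open>\<delta> 1\<close>; conversely \<open>\<delta> x = x \<cdot> c\<close>.\<close>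

lemma separable_extension_iff:
  "separable_extension R S \<longleftrightarrow> (\<exists>c \<in> carrier (pair_group R). free_mult R c = \<one> \<and>
    (\<forall>x \<in> carrier R. free_left R x c - free_right R x c \<in> tensor_null R S))"
proof
  assume "separable_extension R S"
  then obtain \<delta> where hom: "\<delta> \<in> hom (add_monoid R) (tensor_square R S)"
    and bimod: "\<And>r x. \<lbrakk>r \<in> carrier R; x \<in> carrier R\<rbrakk> \<Longrightarrow>
      \<delta> (r \<otimes> x) = tensor_left R S r (\<delta> x) \<and> \<delta> (x \<otimes> r) = tensor_right R S (\<delta> x) r"
    and mult: "\<And>x. x \<in> carrier R \<Longrightarrow> tensor_mult R (\<delta> x) = x"
    unfolding separable_extension_def by blast
  have "\<delta> \<one> \<in> carrier (tensor_square R S)"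
    using hom_in_carrier[OF hom, of \<one>] by simp
  then obtain c where c: "c \<in> carrier (pair_group R)" and \<delta>1: "\<delta> \<one> = tensor_class R S c"
    unfolding tensor_square_def carrier_FactGroup tensor_class_def by blast
  have "free_left R x c - free_right R x c \<in> tensor_null R S" if x: "x \<in> carrier R" for x
  proof -
    \<comment> \<open>Both classes equal \<open>\<delta> x\<close>, with \<open>x\<close> read once
      as \<open>x \<otimes> \<one>\<close> and once as \<open>\<one> \<otimes> x\<close>.\<close>
    have "tensor_class R S (free_left R x c) = tensor_class R S (free_right R x c)"
      unfolding tensor_left_class[OF S x c, symmetric] tensor_right_class[OF S x c, symmetric]
      using bimod[OF x one_closed] x by (metis \<delta>1 l_one r_one)
    then show ?thesis
      using tensor_class_eq_iff free_left_closed[OF x c] free_right_closed[OF x c] by blast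
  qed
  moreover have "free_mult R c = \<one>"
    using mult[OF one_closed] tensor_mult_class[OF S c] by (simp add: \<delta>1)
  ultimately show "\<exists>c \<in> carrier (pair_group R). free_mult R c = \<one> \<and>
    (\<forall>x \<in> carrier R. free_left R x c - free_right R x c \<in> tensor_null R S)"
    using c by blast
next
  assume "\<exists>c \<in> carrier (pair_group R). free_mult R c = \<one> \<and>
    (\<forall>x \<in> carrier R. free_left R x c - free_right R x c \<in> tensor_null R S)"
  then obtain c where c: "c \<in> carrier (pair_group R)" and mult: "free_mult R c = \<one>"
    and comm: "\<And>x. x \<in> carrier R \<Longrightarrow> free_left R x c - free_right R x c \<in> tensor_null R S"
    by blast
  have L: "free_left R x c \<in> carrier (pair_group R)" if "x \<in> carrier R" for x
    by (rule free_left_closed[OF that c])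
  define \<delta> where "\<delta> x = tensor_class R S (free_left R x c)" for x
  have hom: "\<delta> \<in> hom (add_monoid R) (tensor_square R S)"
  proof (rule homI)
    show "\<delta> x \<in> carrier (tensor_square R S)" if "x \<in> carrier (add_monoid R)" for x
      using that L tensor_class_closed[OF L] by (simp add: \<delta>_def)
    show "\<delta> (x \<otimes>\<^bsub>add_monoid R\<^esub> y) = \<delta> x \<otimes>\<^bsub>tensor_square R S\<^esub> \<delta> y"
      if "x \<in> carrier (add_monoid R)" "y \<in> carrier (add_monoid R)" for x y
    proof -
      have xy: "x \<in> carrier R" "y \<in> carrier R" using that by auto
      have "free_left R x c + free_left R y c \<in> carrier (pair_group R)"
        using group.is_monoid[OF group_pair_group(1), THEN monoid.m_closed, OF L[OF xy(1)] L[OF xy(2)]]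
        by simp
      then show ?thesis
        using tensor_class_eq_iff[OF L] free_left_add[OF xy c] xy
        by (simp add: \<delta>_def tensor_class_mult[OF L L])
    qed
  qed
  have left: "\<delta> (r \<otimes> x) = tensor_left R S r (\<delta> x)" if "r \<in> carrier R" "x \<in> carrier R" for r x
    using tensor_left_class[OF S that(1) L[OF that(2)]] free_left_left[OF that c]
    by (simp add: \<delta>_def)
  \<comment> \<open>Inside the left action by \<open>x\<close>, the class of
    \<open>free_left R r c\<close> is exchanged for that of \<open>free_right R r c\<close>; then
    the left and right actions commute.\<close>
  have right: "\<delta> (x \<otimes> r) = tensor_right R S (\<delta> x) r" if r: "r \<in> carrier R" and x: "x \<in> carrier R" for r x
  proof -
    have "\<delta> (x \<otimes> r) = tensor_left R S x (tensor_class R S (free_left R r c))"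
      using left[OF x r] by (simp add: \<delta>_def)
    also have "tensor_class R S (free_left R r c) = tensor_class R S (free_right R r c)"
      using tensor_class_eq_iff[OF L[OF r] free_right_closed[OF r c]] comm[OF r] by blast
    also have "tensor_left R S x \<dots> = tensor_class R S (free_right R r (free_left R x c))"
      using tensor_left_class[OF S x free_right_closed[OF r c]] free_left_right[OF x r c] by simp
    also have "\<dots> = tensor_right R S (\<delta> x) r"
      using tensor_right_class[OF S r L[OF x]] by (simp add: \<delta>_def)
    finally show ?thesis .
  qed
  have "tensor_mult R (\<delta> x) = x" if x: "x \<in> carrier R" for x
    using tensor_mult_class[OF S L[OF x]] free_mult_left[OF x c] mult x by (simp add: \<delta>_def)
  then show "separable_extension R S"
    unfolding separable_extension_def
    by (intro bexI[OF _ hom] conjI ballI) (erule (1) left right | simp)+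
qed

end

end

section \<open>Projections of a graded ring\<close>

text \<open>The gradedness assumption is restated with \<open>R\<close> as the only implicit
  structure, so that unindexed ring notation refers to \<open>R\<close> rather than to
  \<open>G\<close>.\<close>

locale grading = ring R + G: group G
  for G :: "('g, 'm) monoid_scheme" and R :: "('r, 'k) ring_scheme" (structure) +
  fixes A :: "'g \<Rightarrow> 'r set"
  assumes graded: "graded_ring G R A"
begin

lemmas component_subgroup = graded_ring.component_subgroup[OF graded]
lemmas component_mult = graded_ring.component_mult[OF graded]

lemma component_closed: "\<lbrakk>g \<in> carrier G; x \<in> A g\<rbrakk> \<Longrightarrow> x \<in> carrier R"
  by (rule additive_subgroup.a_Hcarr[OF component_subgroup])

lemma component_zero: "g \<in> carrier G \<Longrightarrow> \<zero> \<in> A g"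
  by (rule additive_subgroup.zero_closed[OF component_subgroup])

lemma component_add: "\<lbrakk>g \<in> carrier G; x \<in> A g; y \<in> A g\<rbrakk> \<Longrightarrow> x \<oplus> y \<in> A g"
  by (rule additive_subgroup.a_closed[OF component_subgroup])

lemma component_finsum:
  assumes g: "g \<in> carrier G" and f: "\<And>i. i \<in> I \<Longrightarrow> f i \<in> A g"
  shows "(\<Oplus>i\<in>I. f i) \<in> A g"
  using f
proof (induction I rule: infinite_finite_induct)
  case (insert i I)
  then show ?case
    using g by (simp add: finsum_insert component_closed component_add Pi_def)
qed (use g in \<open>simp_all add: component_zero\<close>)

section \<open>Homogeneous components and projections onto sets of degrees\<close>

definition components :: "'r \<Rightarrow> 'g \<Rightarrow> 'r"
  where "components x = (THE c. c \<in> (\<Pi>\<^sub>E g\<in>carrier G. A g) \<and> finite {g \<in> carrier G. c g \<noteq> \<zero>} \<and>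
        x = (\<Oplus>g\<in>{g \<in> carrier G. c g \<noteq> \<zero>}. c g))"

lemma components:
  assumes "x \<in> carrier R"
  shows "components x \<in> (\<Pi>\<^sub>E g\<in>carrier G. A g)"
    and "finite {g \<in> carrier G. components x g \<noteq> \<zero>}"
    and "x = (\<Oplus>g\<in>{g \<in> carrier G. components x g \<noteq> \<zero>}. components x g)"
  using theI'[OF graded_ring.direct_sum[OF graded assms]] unfolding components_def by auto

lemma components_eqI:
  assumes "x \<in> carrier R" "c \<in> (\<Pi>\<^sub>E g\<in>carrier G. A g)" "finite {g \<in> carrier G. c g \<noteq> \<zero>}"
    "x = (\<Oplus>g\<in>{g \<in> carrier G. c g \<noteq> \<zero>}. c g)"
  shows "components x = c"
  using the1_equality[OF graded_ring.direct_sum[OF graded assms(1)]] assms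
  unfolding components_def by blast

text \<open>An arbitrary set of degrees is allowed because both left cosets of \<open>H\<close> and
  single degrees occur later.\<close>

definition proj :: "'g set \<Rightarrow> 'r \<Rightarrow> 'r"
  where "proj D x = (\<Oplus>g\<in>{g \<in> carrier G. components x g \<noteq> \<zero>} \<inter> D. components x g)"

text \<open>Extending \<open>c\<close> by zero outside \<open>F\<close> gives a family
  \<open>d\<close> to which uniqueness of the decomposition applies. The support of \<open>d\<close>
  may be smaller than \<open>F\<close>, since some \<open>c g\<close> may vanish.\<close>

lemma proj_finsum:
  assumes F: "finite F" "F \<subseteq> carrier G" and c: "\<And>g. g \<in> F \<Longrightarrow> c g \<in> A g"
  shows "proj D (\<Oplus>g\<in>F. c g) = (\<Oplus>g\<in>F \<inter> D. c g)"
proof -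
  define d where "d = (\<lambda>g\<in>carrier G. if g \<in> F then c g else \<zero>)"
  let ?S = "{g \<in> carrier G. d g \<noteq> \<zero>}"
  have S: "?S \<subseteq> F" by (auto simp: d_def split: if_splits)
  have cF: "c g \<in> carrier R" if "g \<in> F" for g using F(2) c component_closed[of g "c g"] that by blast
  have dR: "d g = c g" if "g \<in> F" for g using F that by (auto simp: d_def)
  have "components (\<Oplus>g\<in>F. c g) = d"
  proof (rule components_eqI)
    show "d \<in> (\<Pi>\<^sub>E g\<in>carrier G. A g)" using c by (auto simp: d_def component_zero)
    show "finite ?S" using S F(1) finite_subset by blast
    show "(\<Oplus>g\<in>F. c g) = (\<Oplus>g\<in>?S. d g)"
      by (rule add.finprod_mono_neutral_cong_right) (use S F cF dR in \<open>auto simp: d_def\<close>)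
  qed (use cF in auto)
  moreover have "(\<Oplus>g\<in>?S \<inter> D. d g) = (\<Oplus>g\<in>F \<inter> D. c g)"
    by (rule add.finprod_mono_neutral_cong_left) (use S F cF dR in \<open>auto simp: d_def\<close>)
  ultimately show ?thesis by (simp add: proj_def)
qed

text \<open>Both decompositions are written over the union of their supports, so that they can be
  added and projected index by index.\<close>

lemma proj_add:
  assumes x: "x \<in> carrier R" and y: "y \<in> carrier R"
  shows "proj D (x \<oplus> y) = proj D x \<oplus> proj D y"
proof -
  define c where "c = components x"
  define d where "d = components y"
  define F where "F = {g \<in> carrier G. c g \<noteq> \<zero>} \<union> {g \<in> carrier G. d g \<noteq> \<zero>}"
  have F: "finite F" "F \<subseteq> carrier G" using components(2) x y by (auto simp: F_def c_def d_def)
  have c: "c g \<in> A g" "d g \<in> A g" if "g \<in> F" for g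
    using that F(2) components(1) x y by (auto simp: c_def d_def)
  have cd: "c g \<oplus> d g \<in> A g" if "g \<in> F" for g
    using c[OF that] that F(2) component_add[of g] by blast
  have cR: "c g \<in> carrier R" "d g \<in> carrier R" if "g \<in> F" for g
    using c[OF that] that F(2) component_closed[of g] by blast+
  have x': "x = (\<Oplus>g\<in>F. c g)"
    by (subst components(3)[OF x], rule add.finprod_mono_neutral_cong_left)
      (use F(1) cR in \<open>auto simp: F_def c_def\<close>)
  have y': "y = (\<Oplus>g\<in>F. d g)"
    by (subst components(3)[OF y], rule add.finprod_mono_neutral_cong_left)
      (use F(1) cR in \<open>auto simp: F_def d_def\<close>)
  have "proj D (x \<oplus> y) = proj D (\<Oplus>g\<in>F. c g \<oplus> d g)"
    unfolding x' y' using cR by (subst finsum_addf) auto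
  also have "\<dots> = (\<Oplus>g\<in>F \<inter> D. c g \<oplus> d g)"
    using F cd by (rule proj_finsum)
  also have "\<dots> = (\<Oplus>g\<in>F \<inter> D. c g) \<oplus> (\<Oplus>g\<in>F \<inter> D. d g)"
    using cR by (subst finsum_addf) auto
  also have "\<dots> = proj D x \<oplus> proj D y"
    unfolding x' y' using F c by (simp add: proj_finsum)
  finally show ?thesis .
qed

lemma proj_homogeneous:
  assumes "g \<in> carrier G" "x \<in> A g"
  shows "proj D x = (if g \<in> D then x else \<zero>)"
proof -
  have x: "x \<in> carrier R" using assms by (rule component_closed)
  have g1: "(\<Oplus>k\<in>{g}. x) = x" by (subst finsum_insert) (use x in simp_all)
  have "proj D x = (\<Oplus>k\<in>{g} \<inter> D. x)"
    using proj_finsum[of "{g}" "\<lambda>_. x" D, unfolded g1] assms by simp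
  also have "\<dots> = (if g \<in> D then x else \<zero>)"
    by (cases "g \<in> D") (simp_all only: Int_insert_left if_True if_False Int_empty_left g1 finsum_empty)
  finally show ?thesis .
qed

text \<open>Every element is a finite sum of homogeneous ones. The empty sum falls under the
  homogeneous case, as zero lies in the component of the identity.\<close>

lemma graded_induct [consumes 1, case_names homogeneous add]:
  assumes x: "x \<in> carrier R"
    and hom: "\<And>g x. \<lbrakk>g \<in> carrier G; x \<in> A g\<rbrakk> \<Longrightarrow> P x"
    and add: "\<And>x y. \<lbrakk>x \<in> carrier R; y \<in> carrier R; P x; P y\<rbrakk> \<Longrightarrow> P (x \<oplus> y)"
  shows "P x"
proof -
  have "P (\<Oplus>g\<in>F. c g)" if "finite F" "F \<subseteq> carrier G" "\<And>g. g \<in> F \<Longrightarrow> c g \<in> A g" for F c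
    using that
  proof (induction F)
    case empty
    show ?case using hom[of "\<one>\<^bsub>G\<^esub>" \<zero>] component_zero[OF G.one_closed] by simp
  next
    case (insert g F)
    have "c k \<in> carrier R" if "k \<in> insert g F" for k
      using insert.prems that component_closed[of k "c k"] by auto
    then have "c g \<in> carrier R" "c \<in> F \<rightarrow> carrier R"
      by auto
    then show ?case
      using insert add[of "c g" "\<Oplus>g\<in>F. c g"] hom[of g "c g"] by (simp add: finsum_insert)
  qed
  then show ?thesis
    using components(1,2)[OF x] PiE_mem[OF components(1)[OF x]]
    by (subst components(3)[OF x]) auto
qed

lemma proj_closed: "x \<in> carrier R \<Longrightarrow> proj D x \<in> carrier R"
  by (induction rule: graded_induct) (simp_all add: proj_homogeneous proj_add component_closed)

lemma proj_sum:
  assumes "\<And>i. i \<in> I \<Longrightarrow> f i \<in> carrier R"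
  shows "proj D (\<Oplus>i\<in>I. f i) = (\<Oplus>i\<in>I. proj D (f i))"
  using assms
proof (induction I rule: infinite_finite_induct)
  case (insert i I)
  then have "f i \<in> carrier R" "f \<in> I \<rightarrow> carrier R" "(\<lambda>i. proj D (f i)) \<in> I \<rightarrow> carrier R"
    using proj_closed by auto
  then show ?case
    using insert by (simp add: finsum_insert proj_add proj_closed)
qed (use proj_homogeneous[OF G.one_closed component_zero[OF G.one_closed], of D] in auto)

lemma proj_component:
  assumes g: "g \<in> carrier G" and x: "x \<in> carrier R"
  shows "proj {g} x \<in> A g"
  using x
proof (induction rule: graded_induct)
  case (homogeneous k x)
  then show ?case using g by (cases "k = g") (simp_all add: proj_homogeneous component_zero)
next
  case (add x y)
  then show ?case using g by (simp add: proj_add component_add)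
qed

text \<open>Left multiplication by \<open>s\<close> translates degrees by \<open>g\<close>, and
  \<open>D\<close> is the preimage of \<open>D'\<close> under that translation. It serves for single
  degrees and for the passage from \<open>H\<close> to its translate by \<open>g\<close>.\<close>

lemma proj_homogeneous_times:
  assumes s: "g \<in> carrier G" "s \<in> A g" and x: "x \<in> carrier R"
    and D: "\<And>k. k \<in> carrier G \<Longrightarrow> g \<otimes>\<^bsub>G\<^esub> k \<in> D' \<longleftrightarrow> k \<in> D"
  shows "proj D' (s \<otimes> x) = s \<otimes> proj D x"
  using x
proof (induction rule: graded_induct)
  case (homogeneous k x)
  then show ?case
    using D[of k] component_closed[OF s] G.m_closed[OF s(1) homogeneous(1)]
      proj_homogeneous[OF _ component_mult[OF s(1) homogeneous(1) s(2) homogeneous(2)]]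
    by (simp add: proj_homogeneous)
next
  case (add x y)
  then show ?case
    using component_closed[OF s] by (simp add: proj_add r_distr proj_closed)
qed

text \<open>The mirror image, with degrees translated on the right. A left coset of \<open>H\<close>
  is its own preimage under translation by an element of \<open>H\<close>.\<close>

lemma proj_times_homogeneous:
  assumes s: "g \<in> carrier G" "s \<in> A g" and x: "x \<in> carrier R"
    and D: "\<And>k. k \<in> carrier G \<Longrightarrow> k \<otimes>\<^bsub>G\<^esub> g \<in> D' \<longleftrightarrow> k \<in> D"
  shows "proj D' (x \<otimes> s) = proj D x \<otimes> s"
  using x
proof (induction rule: graded_induct)
  case (homogeneous k x)
  then show ?case
    using D[of k] component_closed[OF s] G.m_closed[OF homogeneous(1) s(1)]
      proj_homogeneous[OF _ component_mult[OF homogeneous(1) s(1) homogeneous(2) s(2)]]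
    by (simp add: proj_homogeneous)
next
  case (add x y)
  then show ?case
    using component_closed[OF s] by (simp add: proj_add l_distr proj_closed)
qed

section \<open>The part supported on a subgroup, and its left cosets\<close>

lemma graded_part_closed:
  assumes "H \<subseteq> carrier G" shows "graded_part R A H \<subseteq> carrier R"
proof -
  have "(\<Oplus>h\<in>F. c h) \<in> carrier R" if "F \<subseteq> H" "c \<in> (\<Pi> h\<in>F. A h)" for F c
  proof (intro finsum_closed Pi_I)
    show "c h \<in> carrier R" if "h \<in> F" for h
      using component_closed[of h "c h"] \<open>F \<subseteq> H\<close> \<open>c \<in> (\<Pi> h\<in>F. A h)\<close> that assms by auto
  qed
  then show ?thesis unfolding graded_part_def by blast
qed

lemma component_subset_graded_part:
  assumes "h \<in> H" "H \<subseteq> carrier G" "x \<in> A h"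
  shows "x \<in> graded_part R A H"
proof -
  have "x \<in> carrier R" using component_closed[of h x] assms by (simp add: subset_iff)
  then have "x = (\<Oplus>_\<in>{h}. x)" by (subst finsum_insert) simp_all
  moreover have "finite {h}" "{h} \<subseteq> H" "(\<lambda>_. x) \<in> (\<Pi> h\<in>{h}. A h)" using assms by auto
  ultimately show ?thesis unfolding graded_part_def by blast
qed

lemma graded_part_induct [consumes 2, case_names homogeneous add]:
  assumes x: "x \<in> graded_part R A H" and H: "subgroup H G"
    and hom: "\<And>h x. \<lbrakk>h \<in> H; x \<in> A h\<rbrakk> \<Longrightarrow> P x"
    and add: "\<And>x y. \<lbrakk>x \<in> carrier R; y \<in> carrier R; P x; P y\<rbrakk> \<Longrightarrow> P (x \<oplus> y)"
  shows "P x"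
proof -
  obtain F c where x: "x = (\<Oplus>h\<in>F. c h)" and F: "finite F" "F \<subseteq> H" "\<And>h. h \<in> F \<Longrightarrow> c h \<in> A h"
    using x unfolding graded_part_def by auto
  from F show ?thesis unfolding x
  proof (induction F)
    case empty
    show ?case using hom[of "\<one>\<^bsub>G\<^esub>" \<zero>] component_zero[OF G.one_closed] subgroup.one_closed[OF H] by simp
  next
    case (insert g F)
    have "c k \<in> carrier R" if "k \<in> insert g F" for k
      using insert.prems that component_closed[of k "c k"] subgroup.mem_carrier[OF H] by auto
    then have "c g \<in> carrier R" "c \<in> F \<rightarrow> carrier R"
      by auto
    then show ?case
      using insert add[of "c g" "\<Oplus>g\<in>F. c g"] hom[of g "c g"] by (simp add: finsum_insert)
  qed
qed

lemma mem_lcoset_iff: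
  assumes "subgroup H G" "g \<in> carrier G" "k \<in> carrier G"
  shows "k \<in> g <#\<^bsub>G\<^esub> H \<longleftrightarrow> inv\<^bsub>G\<^esub> g \<otimes>\<^bsub>G\<^esub> k \<in> H"
  using subgroup.lcos_module_imp[OF assms(1) G.is_group assms(2)]
    subgroup.lcos_module_rev[OF assms(1) G.is_group assms(2,3)] by blast

text \<open>Right translation by an element of \<open>H\<close> preserves each left coset of
  \<open>H\<close>, in both directions because \<open>H\<close> contains inverses. This right
  linearity is what makes the map on the tensor square below balanced.\<close>

lemma proj_times_graded_part:
  assumes H: "subgroup H G" and s: "s \<in> graded_part R A H" and x: "x \<in> carrier R"
    and g: "g \<in> carrier G"
  shows "proj (g <#\<^bsub>G\<^esub> H) (x \<otimes> s) = proj (g <#\<^bsub>G\<^esub> H) x \<otimes> s"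
  using s H
proof (induction rule: graded_part_induct)
  case (homogeneous h s)
  have h: "h \<in> carrier G" using homogeneous(1) subgroup.mem_carrier[OF H] by blast
  have "k \<otimes>\<^bsub>G\<^esub> h \<in> g <#\<^bsub>G\<^esub> H \<longleftrightarrow> k \<in> g <#\<^bsub>G\<^esub> H" if k: "k \<in> carrier G" for k
  proof -
    define m where "m = inv\<^bsub>G\<^esub> g \<otimes>\<^bsub>G\<^esub> k"
    have m: "m \<in> carrier G" using g k by (simp add: m_def)
    then have "m = m \<otimes>\<^bsub>G\<^esub> h \<otimes>\<^bsub>G\<^esub> inv\<^bsub>G\<^esub> h" using h by (simp add: G.m_assoc)
    then have "m \<otimes>\<^bsub>G\<^esub> h \<in> H \<longleftrightarrow> m \<in> H"
      using subgroup.m_closed[OF H] homogeneous(1) subgroup.m_inv_closed[OF H homogeneous(1)] by metis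
    then show ?thesis
      using g h k by (simp add: mem_lcoset_iff[OF H] G.m_assoc m_def)
  qed
  then show ?case
    by (rule proj_times_homogeneous[OF h homogeneous(2) x])
next
  case (add s s')
  then show ?case using x by (simp add: r_distr proj_add proj_closed)
qed

subsection \<open>Projections on the tensor square\<close>

text \<open>For a left coset \<open>D\<close> of \<open>H\<close>, the map \<open>x \<otimes> y \<mapsto> proj D x \<cdot> y\<close> is balanced over
  the \<open>H\<close>-part and therefore descends to the tensor square.\<close>

definition proj_mult :: "'g set \<Rightarrow> (('r \<times> 'r) \<Rightarrow>\<^sub>0 int) \<Rightarrow> 'r"
  where "proj_mult D c = free_mult R (frag_extend (\<lambda>(x, y). frag_of (proj D x, y)) c)"

lemma proj_mult_hom: "proj_mult D \<in> hom (pair_group R) (add_monoid R)"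
proof -
  have "frag_extend (\<lambda>(x, y). frag_of (proj D x, y)) \<in> hom (pair_group R) (pair_group R)"
  proof (rule homI)
    fix c assume "c \<in> carrier (pair_group R)"
    then show "frag_extend (\<lambda>(x, y). frag_of (proj D x, y)) c \<in> carrier (pair_group R)"
      by (auto dest!: subsetD[OF keys_frag_extend] simp: proj_closed)
  qed (simp add: frag_extend_add)
  from hom_compose[OF this free_mult_hom(1)] show ?thesis
    by (simp add: proj_mult_def[abs_def] comp_def)
qed

lemmas proj_mult_zero = pair_group_hom_zero[OF proj_mult_hom]
lemmas proj_mult_diff = pair_group_hom_diff[OF proj_mult_hom]

lemma proj_mult_pure:
  "\<lbrakk>x \<in> carrier R; y \<in> carrier R\<rbrakk> \<Longrightarrow> proj_mult D (frag_of (x, y)) = proj D x \<otimes> y"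
  by (simp add: proj_mult_def free_mult_hom(2) proj_closed)

lemma proj_mult_closed: "c \<in> carrier (pair_group R) \<Longrightarrow> proj_mult D c \<in> carrier R"
  using hom_in_carrier[OF proj_mult_hom] by simp

text \<open>A homomorphism that kills the generating relators kills the subgroup they generate.
  Biadditivity relators vanish by additivity of \<open>proj\<close>, balancing relators by
  \<open>proj_times_graded_part\<close>.\<close>

lemma proj_mult_null:
  assumes H: "subgroup H G" and g: "g \<in> carrier G"
    and c: "c \<in> tensor_null R (graded_part R A H)"
  shows "proj_mult (g <#\<^bsub>G\<^esub> H) c = \<zero>"
proof -
  have S: "graded_part R A H \<subseteq> carrier R"
    using graded_part_closed[OF subgroup.subset[OF H]] .
  have "proj_mult (g <#\<^bsub>G\<^esub> H) d = \<zero>" if "d \<in> tensor_relators R (graded_part R A H)" for d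
  proof -
    from that consider
        x x' y where "d = frag_of (x \<oplus> x', y) - frag_of (x, y) - frag_of (x', y)"
          "x \<in> carrier R" "x' \<in> carrier R" "y \<in> carrier R"
      | x y y' where "d = frag_of (x, y \<oplus> y') - frag_of (x, y) - frag_of (x, y')"
          "x \<in> carrier R" "y \<in> carrier R" "y' \<in> carrier R"
      | x s y where "d = frag_of (x \<otimes> s, y) - frag_of (x, s \<otimes> y)"
          "x \<in> carrier R" "s \<in> graded_part R A H" "y \<in> carrier R"
      unfolding tensor_relators_def by blast
    then show ?thesis
    proof cases
      case 1
      have "frag_of (x \<oplus> x', y) - frag_of (x, y) \<in> carrier (pair_group R)"
        using 1 by (auto dest!: subsetD[OF keys_diff])
      then show ?thesis
        using 1 proj_closed[of x] proj_closed[of x']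
        by (simp add: proj_mult_diff proj_mult_pure proj_add) algebra
    next
      case 2
      have "frag_of (x, y \<oplus> y') - frag_of (x, y) \<in> carrier (pair_group R)"
        using 2 by (auto dest!: subsetD[OF keys_diff])
      then show ?thesis
        using 2 proj_closed[of x]
        by (simp add: proj_mult_diff proj_mult_pure) algebra
    next
      case 3
      then have s: "s \<in> carrier R" using S by auto
      then show ?thesis
        using 3 proj_closed[of x] proj_times_graded_part[OF H 3(3) 3(2) g]
        by (simp add: proj_mult_diff proj_mult_pure m_assoc r_neg a_minus_def)
    qed
  qed
  then have "proj_mult (g <#\<^bsub>G\<^esub> H) ` tensor_relators R (graded_part R A H) \<subseteq> {\<zero>}" by auto
  then show ?thesis
    using hom_tensor_null[OF S proj_mult_hom a_group add.triv_subgroup _ c] by auto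
qed

text \<open>Only the first tensor factor is projected, so left multiplication by a homogeneous
  element shifts the set of degrees, whereas right multiplication simply factors out.\<close>

lemma proj_mult_left:
  assumes s: "g \<in> carrier G" "s \<in> A g" and c: "c \<in> carrier (pair_group R)"
    and D: "\<And>k. k \<in> carrier G \<Longrightarrow> g \<otimes>\<^bsub>G\<^esub> k \<in> D' \<longleftrightarrow> k \<in> D"
  shows "proj_mult D' (free_left R s c) = s \<otimes> proj_mult D c"
  using c
proof (induction rule: pair_group_induct)
  case zero
  then show ?case using component_closed[OF s] by (simp add: free_left_simps proj_mult_zero)
next
  case (pure x y)
  then show ?case
    using component_closed[OF s] proj_homogeneous_times[OF s pure(1) D] proj_closed[of x]
    by (simp add: free_left_simps proj_mult_pure m_assoc)
next
  case (diff a b)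
  then show ?case
    using component_closed[OF s]
    by (simp only: free_left_simps proj_mult_diff free_left_closed proj_mult_closed
        a_minus_def r_distr r_minus a_inv_closed)
qed

lemma proj_mult_right:
  assumes s: "s \<in> carrier R" and c: "c \<in> carrier (pair_group R)"
  shows "proj_mult D (free_right R s c) = proj_mult D c \<otimes> s"
  using c
proof (induction rule: pair_group_induct)
  case zero
  then show ?case using s by (simp add: free_right_simps proj_mult_zero)
next
  case (pure x y)
  then show ?case
    using s proj_closed[of x] by (simp add: free_right_simps proj_mult_pure m_assoc)
next
  case (diff a b)
  then show ?case
    using s
    by (simp only: free_right_simps proj_mult_diff free_right_closed proj_mult_closed
        a_minus_def l_distr l_minus a_inv_closed)
qed

end

section \<open>The trace criterion\<close>

locale graded_transversal = grading G R A
  for G :: "('g, 'm) monoid_scheme" and R :: "('r, 'k) ring_scheme" (structure)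
    and A :: "'g \<Rightarrow> 'r set" +
  fixes H T :: "'g set" and n :: "'g \<Rightarrow> nat" and u v :: "'g \<Rightarrow> nat \<Rightarrow> 'r"
  assumes H: "subgroup H G"
    and u: "\<lbrakk>g \<in> carrier G; i \<in> {1..n g}\<rbrakk> \<Longrightarrow> u g i \<in> A g"
    and v: "\<lbrakk>g \<in> carrier G; i \<in> {1..n g}\<rbrakk> \<Longrightarrow> v (inv\<^bsub>G\<^esub> g) i \<in> A (inv\<^bsub>G\<^esub> g)"
    and uv: "g \<in> carrier G \<Longrightarrow> (\<Oplus>i\<in>{1..n g}. u g i \<otimes> v (inv\<^bsub>G\<^esub> g) i) = \<one>"
    and T: "left_transversal G H T"
begin

lemma u_closed: "\<lbrakk>g \<in> carrier G; i \<in> {1..n g}\<rbrakk> \<Longrightarrow> u g i \<in> carrier R"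
  by (rule component_closed[OF _ u])

lemma v_closed: "\<lbrakk>g \<in> carrier G; i \<in> {1..n g}\<rbrakk> \<Longrightarrow> v (inv\<^bsub>G\<^esub> g) i \<in> carrier R"
  by (rule component_closed[OF G.inv_closed v])

text \<open>The given decomposition of \<open>\<one>\<close> at the identity of \<open>G\<close> is
  a sum of products whose degree is the identity.\<close>

lemma one_component: "\<one> \<in> A \<one>\<^bsub>G\<^esub>"
proof -
  have "(\<Oplus>i\<in>{1..n \<one>\<^bsub>G\<^esub>}. u \<one>\<^bsub>G\<^esub> i \<otimes> v (inv\<^bsub>G\<^esub> \<one>\<^bsub>G\<^esub>) i) \<in> A \<one>\<^bsub>G\<^esub>"
  proof (rule component_finsum[OF G.one_closed])
    fix i assume i: "i \<in> {1..n \<one>\<^bsub>G\<^esub>}"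
    show "u \<one>\<^bsub>G\<^esub> i \<otimes> v (inv\<^bsub>G\<^esub> \<one>\<^bsub>G\<^esub>) i \<in> A \<one>\<^bsub>G\<^esub>"
      using component_mult[OF G.one_closed G.inv_closed[OF G.one_closed]
          u[OF G.one_closed i] v[OF G.one_closed i]] by simp
  qed
  then show ?thesis by (simp only: uv[OF G.one_closed])
qed

section \<open>Left transversals and cosets\<close>

lemma T_carrier: "t \<in> T \<Longrightarrow> t \<in> carrier G"
  using T unfolding left_transversal_def by auto

lemma transversal_ex1:
  assumes "g \<in> carrier G" shows "\<exists>!t. t \<in> T \<and> t \<in> g <#\<^bsub>G\<^esub> H"
proof -
  have "g <#\<^bsub>G\<^esub> H \<in> lcosets\<^bsub>G\<^esub> H" using assms unfolding LCOSETS_def by blast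
  then show ?thesis using T unfolding left_transversal_def by blast
qed

lemma coset_swap:
  "\<lbrakk>g \<in> carrier G; k \<in> carrier G\<rbrakk> \<Longrightarrow> g \<in> k <#\<^bsub>G\<^esub> H \<longleftrightarrow> k \<in> g <#\<^bsub>G\<^esub> H"
  using G.l_coset_swap[OF _ _ H] by metis

text \<open>Sending a representative to its coset is onto by existence of representatives and
  injective by their uniqueness.\<close>

lemma finite_transversal_iff: "finite T \<longleftrightarrow> finite (lcosets\<^bsub>G\<^esub> H)"
proof
  assume fin: "finite T"
  have "lcosets\<^bsub>G\<^esub> H \<subseteq> (\<lambda>t. t <#\<^bsub>G\<^esub> H) ` T"
  proof
    fix C assume "C \<in> lcosets\<^bsub>G\<^esub> H"
    then obtain g where g: "g \<in> carrier G" "C = g <#\<^bsub>G\<^esub> H" unfolding LCOSETS_def by blast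
    then obtain t where "t \<in> T" "t \<in> g <#\<^bsub>G\<^esub> H" using transversal_ex1 by blast
    then show "C \<in> (\<lambda>t. t <#\<^bsub>G\<^esub> H) ` T"
      using G.l_repr_independence[OF _ g(1) H] g(2) by blast
  qed
  then show "finite (lcosets\<^bsub>G\<^esub> H)" using fin finite_surj by blast
next
  assume fin: "finite (lcosets\<^bsub>G\<^esub> H)"
  have "inj_on (\<lambda>t. t <#\<^bsub>G\<^esub> H) T"
  proof (rule inj_onI)
    fix t t' assume t: "t \<in> T" "t' \<in> T" "t <#\<^bsub>G\<^esub> H = t' <#\<^bsub>G\<^esub> H"
    then have "t \<in> t <#\<^bsub>G\<^esub> H" "t' \<in> t <#\<^bsub>G\<^esub> H"
      using G.lcos_self[OF T_carrier H] by auto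
    then show "t = t'" using transversal_ex1[OF T_carrier[OF t(1)]] t by blast
  qed
  moreover have "(\<lambda>t. t <#\<^bsub>G\<^esub> H) ` T \<subseteq> lcosets\<^bsub>G\<^esub> H"
    using T_carrier unfolding LCOSETS_def by blast
  ultimately show "finite T" using fin finite_subset finite_imageD by blast
qed

section \<open>The maps \<gamma> and their compatibility with degrees\<close>

lemma grade_map_closed:
  "\<lbrakk>g \<in> carrier G; x \<in> carrier R\<rbrakk> \<Longrightarrow> grade_map G R n u v g x \<in> carrier R"
  unfolding grade_map_def by (intro finsum_closed Pi_I m_closed u_closed v_closed)

text \<open>Each summand conjugates degrees by \<open>g\<close>, and a conjugate is the identity
  only for the identity. This later allows an element to be replaced by its identity component under
  the trace.\<close>

lemma proj_grade_map:
  assumes g: "g \<in> carrier G" and x: "x \<in> carrier R"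
  shows "proj {\<one>\<^bsub>G\<^esub>} (grade_map G R n u v g x) = grade_map G R n u v g (proj {\<one>\<^bsub>G\<^esub>} x)"
proof -
  have "proj {\<one>\<^bsub>G\<^esub>} (u g i \<otimes> x \<otimes> v (inv\<^bsub>G\<^esub> g) i) = u g i \<otimes> proj {\<one>\<^bsub>G\<^esub>} x \<otimes> v (inv\<^bsub>G\<^esub> g) i"
    if i: "i \<in> {1..n g}" for i
  proof -
    have "proj {\<one>\<^bsub>G\<^esub>} (u g i \<otimes> x \<otimes> v (inv\<^bsub>G\<^esub> g) i) = proj {g} (u g i \<otimes> x) \<otimes> v (inv\<^bsub>G\<^esub> g) i"
      by (rule proj_times_homogeneous[OF G.inv_closed[OF g] v[OF g i] m_closed[OF u_closed[OF g i] x]])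
        (use g G.inv_equality G.inv_inv in fastforce)
    also have "proj {g} (u g i \<otimes> x) = u g i \<otimes> proj {\<one>\<^bsub>G\<^esub>} x"
      by (rule proj_homogeneous_times[OF g u[OF g i] x]) (use g in simp)
    finally show ?thesis .
  qed
  then show ?thesis
    unfolding grade_map_def using g x u_closed v_closed proj_closed
    by (subst proj_sum) (auto intro!: finsum_cong' m_closed)
qed

text \<open>Moving \<open>a\<close> to the left past each \<open>u g i\<close> turns it into
  \<open>b\<close>; what remains is \<open>b\<close> times the decomposition of
  \<open>\<one>\<close>.\<close>

lemma grade_map_eqI:
  assumes g: "g \<in> carrier G" and a: "a \<in> carrier R" and b: "b \<in> carrier R"
    and ab: "\<And>x. x \<in> A g \<Longrightarrow> x \<otimes> a = b \<otimes> x"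
  shows "grade_map G R n u v g a = b"
proof -
  have "grade_map G R n u v g a = (\<Oplus>i\<in>{1..n g}. b \<otimes> (u g i \<otimes> v (inv\<^bsub>G\<^esub> g) i))"
    unfolding grade_map_def
    using ab[OF u[OF g]] b u_closed[OF g] v_closed[OF g]
    by (intro finsum_cong') (auto simp: m_assoc)
  also have "\<dots> = b \<otimes> \<one>"
    unfolding uv[OF g, symmetric] using b u_closed[OF g] v_closed[OF g]
    by (intro finsum_rdistr[symmetric]) auto
  finally show ?thesis using b by simp
qed

subsection \<open>From a separability element to the trace condition\<close>

text \<open>This stands for the sum over \<open>T\<close> of a finitely supported family before
  \<open>T\<close> is known to be finite; \<open>finsum\<close> over an infinite set would default
  to zero.\<close>

definition eventual_sum :: "('g \<Rightarrow> 'r) \<Rightarrow> 'r \<Rightarrow> bool"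
  where "eventual_sum f y \<longleftrightarrow> (\<exists>K0. finite K0 \<and> K0 \<subseteq> T \<and>
    (\<forall>K. finite K \<longrightarrow> K0 \<subseteq> K \<longrightarrow> K \<subseteq> T \<longrightarrow> (\<Oplus>t\<in>K. f t) = y))"

text \<open>Beyond the union of the two threshold sets both given sums have reached their
  values.\<close>

lemma eventual_sum_combine:
  assumes "eventual_sum f y" "eventual_sum f' y'"
    and "\<And>K. \<lbrakk>finite K; K \<subseteq> T; (\<Oplus>t\<in>K. f t) = y; (\<Oplus>t\<in>K. f' t) = y'\<rbrakk> \<Longrightarrow> (\<Oplus>t\<in>K. f'' t) = y''"
  shows "eventual_sum f'' y''"
proof -
  obtain K0 K1 where "finite K0" "K0 \<subseteq> T" "finite K1" "K1 \<subseteq> T"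
    and "\<And>K. \<lbrakk>finite K; K0 \<subseteq> K; K \<subseteq> T\<rbrakk> \<Longrightarrow> (\<Oplus>t\<in>K. f t) = y"
    and "\<And>K. \<lbrakk>finite K; K1 \<subseteq> K; K \<subseteq> T\<rbrakk> \<Longrightarrow> (\<Oplus>t\<in>K. f' t) = y'"
    using assms(1,2) unfolding eventual_sum_def by metis
  then show ?thesis
    unfolding eventual_sum_def using assms(3) by (intro exI[of _ "K0 \<union> K1"]) auto
qed

text \<open>The cosets partition \<open>G\<close>, so a homogeneous element survives in exactly one
  projection, the one at the representative \<open>t0\<close> of its degree. Additivity does the
  rest.\<close>

lemma eventual_sum_proj:
  assumes "x \<in> carrier R"
  shows "eventual_sum (\<lambda>t. proj (t <#\<^bsub>G\<^esub> H) x) x"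
  using assms
proof (induction rule: graded_induct)
  case (homogeneous g x)
  obtain t0 where t0: "t0 \<in> T" "t0 \<in> g <#\<^bsub>G\<^esub> H"
    and unique: "\<And>t. \<lbrakk>t \<in> T; t \<in> g <#\<^bsub>G\<^esub> H\<rbrakk> \<Longrightarrow> t = t0"
    using transversal_ex1[OF homogeneous(1)] by blast
  have x: "x \<in> carrier R" using homogeneous by (rule component_closed)
  have "(\<Oplus>t\<in>K. proj (t <#\<^bsub>G\<^esub> H) x) = x" if K: "finite K" "{t0} \<subseteq> K" "K \<subseteq> T" for K
  proof -
    have "proj (t <#\<^bsub>G\<^esub> H) x = (if t = t0 then x else \<zero>)" if "t \<in> K" for t
    proof -
      have "t \<in> T" using that K by auto
      then have "g \<in> t <#\<^bsub>G\<^esub> H \<longleftrightarrow> t = t0"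
        using coset_swap[OF homogeneous(1) T_carrier] t0 unique by metis
      then show ?thesis by (simp add: proj_homogeneous[OF homogeneous])
    qed
    then have "(\<Oplus>t\<in>K. proj (t <#\<^bsub>G\<^esub> H) x) = (\<Oplus>t\<in>K. if t = t0 then x else \<zero>)"
      using x by (intro finsum_cong') auto
    also have "\<dots> = x"
      using K x by (intro add.finprod_singleton_swap) auto
    finally show ?thesis .
  qed
  then show ?case unfolding eventual_sum_def using t0 by (intro exI[of _ "{t0}"]) simp
next
  case (add x y)
  show ?case
    by (rule eventual_sum_combine[OF add(3,4)])
      (use add(1,2) in \<open>simp add: proj_add proj_closed finsum_addf Pi_def\<close>)
qed

lemma eventual_sum_proj_mult:
  assumes "c \<in> carrier (pair_group R)"
  shows "eventual_sum (\<lambda>t. proj_mult (t <#\<^bsub>G\<^esub> H) c) (free_mult R c)"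
  using assms
proof (induction rule: pair_group_induct)
  case zero
  then show ?case
    by (auto simp: eventual_sum_def proj_mult_zero pair_group_hom_zero[OF free_mult_hom(1)])
next
  case (pure x y)
  show ?case
    \<comment> \<open>Only one sum is transformed here, by right multiplication with
      \<open>y\<close>, so the same fact fills both inputs.\<close>
    by (rule eventual_sum_combine[OF eventual_sum_proj[OF pure(1)] eventual_sum_proj[OF pure(1)]])
      (use pure in \<open>simp add: proj_mult_pure free_mult_hom(2) finsum_ldistr[symmetric] proj_closed Pi_def\<close>)
next
  case (diff a b)
  show ?case
    by (rule eventual_sum_combine[OF diff(3,4)])
      (simp only: proj_mult_diff[OF diff(1,2)] pair_group_hom_diff[OF free_mult_hom(1) diff(1,2)]
        finsum_diff Pi_I proj_mult_closed[OF diff(1)] proj_mult_closed[OF diff(2)])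
qed

lemma mult_mem_lcoset_iff:
  assumes "g \<in> carrier G" "k \<in> carrier G"
  shows "g \<otimes>\<^bsub>G\<^esub> k \<in> g <#\<^bsub>G\<^esub> H \<longleftrightarrow> k \<in> H"
  using assms by (simp add: mem_lcoset_iff[OF H] G.m_assoc[symmetric])

lemma separable_imp_trace:
  assumes one: "\<one> \<noteq> \<zero>" and c: "c \<in> carrier (pair_group R)" and mult: "free_mult R c = \<one>"
    and comm: "\<And>x. x \<in> carrier R \<Longrightarrow>
      free_left R x c - free_right R x c \<in> tensor_null R (graded_part R A H)"
  shows "finite T \<and> (\<exists>r \<in> centralizer_in R (A \<one>\<^bsub>G\<^esub>) (graded_part R A H). rel_trace G R n u v T r = \<one>)"
proof -
  let ?\<gamma> = "grade_map G R n u v"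
  define a where "a g = proj_mult (g <#\<^bsub>G\<^esub> H) c" for g
  define b where "b = proj_mult H c"
  have a_closed: "a g \<in> carrier R" for g unfolding a_def by (rule proj_mult_closed[OF c])
  have b_closed: "b \<in> carrier R" unfolding b_def by (rule proj_mult_closed[OF c])
  \<comment> \<open>The projection belonging to the coset of \<open>g\<close> is applied to the null
    element \<open>free_left R x c - free_right R x c\<close>; its first term yields
    \<open>x \<otimes> b\<close>, its second \<open>a g \<otimes> x\<close>.\<close>
  have shift: "x \<otimes> b = a g \<otimes> x" if g: "g \<in> carrier G" and xg: "x \<in> A g" for g x
  proof -
    have x: "x \<in> carrier R" using g xg by (rule component_closed)
    have LR: "free_left R x c \<in> carrier (pair_group R)" "free_right R x c \<in> carrier (pair_group R)"
      using free_left_closed[OF x c] free_right_closed[OF x c] by auto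
    have "proj_mult (g <#\<^bsub>G\<^esub> H) (free_left R x c) \<ominus> proj_mult (g <#\<^bsub>G\<^esub> H) (free_right R x c) = \<zero>"
      using proj_mult_null[OF H g comm[OF x]] proj_mult_diff[OF LR] by simp
    then have "proj_mult (g <#\<^bsub>G\<^esub> H) (free_left R x c) = proj_mult (g <#\<^bsub>G\<^esub> H) (free_right R x c)"
      using minus_equality[OF _ a_inv_closed] proj_mult_closed[OF LR(1)] proj_mult_closed[OF LR(2)]
      by (metis a_minus_def minus_minus)
    then show ?thesis
      unfolding a_def b_def
      using proj_mult_left[OF g xg c mult_mem_lcoset_iff[OF g]] proj_mult_right[OF x c] by simp
  qed
  have a_eq: "a g = ?\<gamma> g b" if g: "g \<in> carrier G" for g
    using grade_map_eqI[OF g b_closed a_closed shift[OF g]] by simp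
  obtain K0 where K0: "finite K0" "K0 \<subseteq> T"
    and sum: "\<And>K. \<lbrakk>finite K; K0 \<subseteq> K; K \<subseteq> T\<rbrakk> \<Longrightarrow> (\<Oplus>t\<in>K. a t) = \<one>"
    using eventual_sum_proj_mult[OF c] mult unfolding eventual_sum_def a_def by auto
  have fin: "finite T"
  proof (rule ccontr)
    assume "infinite T"
    then obtain t where t: "t \<in> T" "t \<notin> K0" using K0 by (meson finite_subset subsetI)
    have tG: "t \<in> carrier G" using t T_carrier by blast
    \<comment> \<open>Both \<open>K0\<close> and \<open>insert t K0\<close> have sum
      \<open>\<one>\<close>, which forces \<open>a t\<close> to vanish.\<close>
    have "\<one> = a t \<oplus> (\<Oplus>t\<in>K0. a t)"
      using sum[of "insert t K0"] K0 t a_closed by (simp add: finsum_insert Pi_def subset_insertI)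
    then have "a t \<oplus> \<one> = \<one>" using sum[OF K0(1) subset_refl K0(2)] by simp
    then have at: "a t = \<zero>" using add.r_cancel_one[OF one_closed a_closed] by simp
    have "b = \<zero>"
    proof -
      \<comment> \<open>For the inverse of \<open>t\<close> the right-hand family has degree
        \<open>t\<close>, so \<open>shift\<close> turns each product with \<open>b\<close> into a
        multiple of \<open>a t\<close>. Expanding \<open>\<one>\<close> in front of \<open>b\<close>
        then kills \<open>b\<close>.\<close>
      let ?t = "inv\<^bsub>G\<^esub> t"
      have t': "?t \<in> carrier G" using tG by simp
      have vb: "v (inv\<^bsub>G\<^esub> ?t) i \<otimes> b = \<zero>" if i: "i \<in> {1..n ?t}" for i
        using shift[of t "v (inv\<^bsub>G\<^esub> ?t) i"] v[OF t' i] v_closed[OF t' i] tG at by simp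
      have "b = (\<Oplus>i\<in>{1..n ?t}. u ?t i \<otimes> v (inv\<^bsub>G\<^esub> ?t) i) \<otimes> b"
        using uv[OF t'] b_closed by simp
      also have "\<dots> = (\<Oplus>i\<in>{1..n ?t}. u ?t i \<otimes> v (inv\<^bsub>G\<^esub> ?t) i \<otimes> b)"
        using b_closed u_closed[OF t'] v_closed[OF t'] by (intro finsum_ldistr) auto
      also have "\<dots> = (\<Oplus>i\<in>{1..n ?t}. \<zero>)"
        using b_closed u_closed[OF t'] v_closed[OF t'] vb
        by (intro finsum_cong') (auto simp: m_assoc)
      finally show ?thesis by simp
    qed
    then have "a g = \<zero>" if "g \<in> carrier G" for g
      unfolding a_eq[OF that] grade_map_def
      using u_closed[OF that] v_closed[OF that] by (intro add.finprod_one_eqI) auto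
    then have "(\<Oplus>t\<in>K0. a t) = \<zero>"
      using K0 T_carrier by (intro add.finprod_one_eqI) auto
    then show False using sum[OF K0(1) subset_refl K0(2)] one by simp
  qed
  \<comment> \<open>\<open>b\<close> commutes with the \<open>H\<close>-part but need not be
    homogeneous; its identity component is taken to land in the required component.\<close>
  define r where "r = proj {\<one>\<^bsub>G\<^esub>} b"
  have r: "r \<in> A \<one>\<^bsub>G\<^esub>" "r \<in> carrier R"
    unfolding r_def using proj_component[OF G.one_closed b_closed] proj_closed[OF b_closed] by auto
  have "r \<otimes> y = y \<otimes> r" if "y \<in> graded_part R A H" for y
    using that H
  proof (induction rule: graded_part_induct)
    case (homogeneous h x)
    have h: "h \<in> carrier G" using homogeneous(1) by (rule subgroup.mem_carrier[OF H])
    have x: "x \<in> carrier R" using h homogeneous(2) by (rule component_closed)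
    have "h <#\<^bsub>G\<^esub> H = H"
      using G.coset_join3[OF h H homogeneous(1)] .
    then have "x \<otimes> b = b \<otimes> x" using shift[OF h homogeneous(2)] by (simp add: a_def b_def)
    \<comment> \<open>Comparing degree \<open>h\<close> on both sides of
      \<open>x \<otimes> b = b \<otimes> x\<close> isolates \<open>r\<close>.\<close>
    moreover have "proj {h} (x \<otimes> b) = x \<otimes> r" unfolding r_def
      by (rule proj_homogeneous_times[OF h homogeneous(2) b_closed]) (use h in simp)
    moreover have "proj {h} (b \<otimes> x) = r \<otimes> x" unfolding r_def
      by (rule proj_times_homogeneous[OF h homogeneous(2) b_closed]) (use h in simp)
    ultimately show ?case by simp
  next
    case (add x y)
    then show ?case using r by (simp add: l_distr r_distr)
  qed
  then have "r \<in> centralizer_in R (A \<one>\<^bsub>G\<^esub>) (graded_part R A H)"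
    using r by (simp add: centralizer_in_def)
  moreover have "rel_trace G R n u v T r = \<one>"
  proof -
    \<comment> \<open>\<open>\<one>\<close> is its own identity component, so the whole sum of the
      \<open>a t\<close> may be projected without changing its value.\<close>
    have "\<one> = proj {\<one>\<^bsub>G\<^esub>} (\<Oplus>t\<in>T. a t)"
      using sum[OF fin K0(2)] proj_homogeneous[OF G.one_closed one_component] by simp
    also have "\<dots> = (\<Oplus>t\<in>T. proj {\<one>\<^bsub>G\<^esub>} (a t))"
      using a_closed by (rule proj_sum)
    also have "\<dots> = (\<Oplus>t\<in>T. ?\<gamma> t r)"
      using T_carrier a_eq proj_grade_map[OF _ b_closed] grade_map_closed r
      by (intro finsum_cong') (auto simp: r_def)
    finally show ?thesis by (simp add: rel_trace_def)
  qed
  ultimately show ?thesis using fin by blast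
qed

subsection \<open>From the trace condition to a separability element\<close>

lemma trace_imp_separable:
  assumes fin: "finite T" and r_cent: "r \<in> centralizer_in R (A \<one>\<^bsub>G\<^esub>) (graded_part R A H)"
    and trace: "rel_trace G R n u v T r = \<one>"
  shows "separable_extension R (graded_part R A H)"
proof -
  let ?S = "graded_part R A H"
  let ?N = "tensor_null R ?S"
  have S: "?S \<subseteq> carrier R" by (rule graded_part_closed[OF subgroup.subset[OF H]])
  note null_sum = tensor_null_cong_sum[OF S]
    and null_trans = tensor_null_cong_trans[OF S]
    and null_sym = tensor_null_cong_sym[OF S]
  have r: "r \<in> carrier R" and r_comm: "\<And>s. s \<in> ?S \<Longrightarrow> r \<otimes> s = s \<otimes> r"
    using r_cent component_closed[OF G.one_closed] by (auto simp: centralizer_in_def)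
  \<comment> \<open>Attaching \<open>r\<close> to the first factor makes \<open>c\<close> multiply
    out to the relative trace of \<open>r\<close>.\<close>
  define U where "U t i = u t i \<otimes> r" for t i
  define V where "V t i = v (inv\<^bsub>G\<^esub> t) i" for t i
  define c where "c = (\<Sum>t\<in>T. \<Sum>i\<in>{1..n t}. frag_of (U t i, V t i))"
  have u': "u t i \<in> carrier R" and U: "U t i \<in> carrier R" and V: "V t i \<in> carrier R"
    if "t \<in> T" "i \<in> {1..n t}" for t i
    using that u_closed[OF T_carrier] v_closed[OF T_carrier] r by (auto simp: U_def V_def)
  have c: "c \<in> carrier (pair_group R)"
    unfolding c_def using U V by (intro pair_group_sum_closed) auto
  have "free_mult R c = (\<Oplus>t\<in>T. grade_map G R n u v t r)"
  proof -
    have "free_mult R c = (\<Oplus>t\<in>T. free_mult R (\<Sum>i\<in>{1..n t}. frag_of (U t i, V t i)))"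
      unfolding c_def using U V
      by (intro pair_group_hom_sum[OF free_mult_hom(1) fin] pair_group_sum_closed) auto
    also have "\<dots> = (\<Oplus>t\<in>T. grade_map G R n u v t r)"
    proof (rule finsum_cong')
      fix t assume t: "t \<in> T"
      have "free_mult R (\<Sum>i\<in>{1..n t}. frag_of (U t i, V t i)) =
          (\<Oplus>i\<in>{1..n t}. free_mult R (frag_of (U t i, V t i)))"
        using U[OF t] V[OF t] by (intro pair_group_hom_sum[OF free_mult_hom(1)]) auto
      also have "\<dots> = (\<Oplus>i\<in>{1..n t}. U t i \<otimes> V t i)"
        using U[OF t] V[OF t] by (intro finsum_cong') (auto simp: free_mult_hom(2))
      finally show "free_mult R (\<Sum>i\<in>{1..n t}. frag_of (U t i, V t i)) = grade_map G R n u v t r"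
        by (simp add: grade_map_def U_def V_def)
    qed (use grade_map_closed[OF T_carrier r] in auto)
    finally show ?thesis .
  qed
  then have mult: "free_mult R c = \<one>" using trace by (simp add: rel_trace_def)
  have casimir: "free_left R x c - free_right R x c \<in> ?N"
    if g: "g \<in> carrier G" and xg: "x \<in> A g" for g x
  proof -
    have x: "x \<in> carrier R" using g xg by (rule component_closed)
    \<comment> \<open>\<open>P t\<close> and \<open>Q t\<close> are the blocks at \<open>t\<close>
      of the left and the right multiple of \<open>c\<close> by \<open>x\<close>. The blocks are
      matched along the action of \<open>g\<close> on cosets.\<close>
    define P where "P t = (\<Sum>i\<in>{1..n t}. frag_of (x \<otimes> U t i, V t i))" for t
    define Q where "Q t = (\<Sum>i\<in>{1..n t}. frag_of (U t i, V t i \<otimes> x))" for t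
    have move: "P t - Q t' \<in> ?N"
      if t: "t \<in> T" and t': "t' \<in> T" and tt': "t' \<in> g \<otimes>\<^bsub>G\<^esub> t <#\<^bsub>G\<^esub> H" for t t'
    proof -
      have tG: "t \<in> carrier G" "t' \<in> carrier G" using t t' T_carrier by auto
      have deg: "inv\<^bsub>G\<^esub> t' \<otimes>\<^bsub>G\<^esub> g \<otimes>\<^bsub>G\<^esub> t \<in> H"
        using tt' g tG coset_swap[of t' "g \<otimes>\<^bsub>G\<^esub> t"] mem_lcoset_iff[OF H, of t' "g \<otimes>\<^bsub>G\<^esub> t"]
        by (simp add: G.m_assoc)
      \<comment> \<open>By \<open>deg\<close>, these products have degree in \<open>H\<close>, so
        they commute with \<open>r\<close> and may cross the tensor sign.\<close>
      define w where "w j i = V t' j \<otimes> x \<otimes> u t i" for j i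
      have wS: "w j i \<in> ?S" if "j \<in> {1..n t'}" "i \<in> {1..n t}" for j i
      proof (rule component_subset_graded_part[OF deg subgroup.subset[OF H]])
        show "w j i \<in> A (inv\<^bsub>G\<^esub> t' \<otimes>\<^bsub>G\<^esub> g \<otimes>\<^bsub>G\<^esub> t)"
          unfolding w_def V_def using tG g xg u[OF tG(1) that(2)] v[OF tG(2) that(1)]
          by (intro component_mult) auto
      qed
      have w: "w j i \<in> carrier R" if "j \<in> {1..n t'}" "i \<in> {1..n t}" for j i
        using wS[OF that] S by auto
      \<comment> \<open>The decomposition of \<open>\<one>\<close> at \<open>t'\<close> is inserted
        on the left; \<open>r\<close> then commutes past \<open>w j i\<close> to complete
        \<open>U t' j\<close>.\<close>
      have expand: "x \<otimes> U t i = (\<Oplus>j\<in>{1..n t'}. U t' j \<otimes> w j i)" if i: "i \<in> {1..n t}" for i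
      proof -
        have "x \<otimes> U t i = (\<Oplus>j\<in>{1..n t'}. u t' j \<otimes> V t' j) \<otimes> (x \<otimes> U t i)"
          using uv[OF tG(2)] x U[OF t i] by (simp add: V_def)
        also have "\<dots> = (\<Oplus>j\<in>{1..n t'}. u t' j \<otimes> V t' j \<otimes> (x \<otimes> U t i))"
          using x U[OF t i] u'[OF t'] V[OF t'] by (intro finsum_ldistr) auto
        also have "\<dots> = (\<Oplus>j\<in>{1..n t'}. U t' j \<otimes> w j i)"
        proof (rule finsum_cong')
          fix j assume j: "j \<in> {1..n t'}"
          have "u t' j \<otimes> V t' j \<otimes> (x \<otimes> U t i) = u t' j \<otimes> (w j i \<otimes> r)"
            using x r u'[OF t i] u'[OF t' j] V[OF t' j] by (simp add: U_def w_def m_assoc)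
          also have "\<dots> = U t' j \<otimes> w j i"
            using r_comm[OF wS[OF j i]] r u'[OF t' j] w[OF j i] by (simp add: U_def m_assoc)
          finally show "u t' j \<otimes> V t' j \<otimes> (x \<otimes> U t i) = U t' j \<otimes> w j i" .
        qed (use U[OF t'] w i in auto)
        finally show ?thesis .
      qed
      have "frag_of (x \<otimes> U t i, V t i) - (\<Sum>j\<in>{1..n t'}. frag_of (U t' j, w j i \<otimes> V t i)) \<in> ?N"
        if i: "i \<in> {1..n t}" for i
        unfolding expand[OF i]
      proof (rule null_trans[OF tensor_null_finsum_left[OF S] null_sum])
        fix j assume j: "j \<in> {1..n t'}"
        show "frag_of (U t' j \<otimes> w j i, V t i) - frag_of (U t' j, w j i \<otimes> V t i) \<in> ?N"
          by (rule tensor_null_relators(3)[OF S U[OF t' j] wS[OF j i] V[OF t i]])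
      qed (use U[OF t'] w V[OF t] i in auto)
      then have "P t - (\<Sum>i\<in>{1..n t}. \<Sum>j\<in>{1..n t'}. frag_of (U t' j, w j i \<otimes> V t i)) \<in> ?N"
        unfolding P_def by (rule null_sum)
      \<comment> \<open>With \<open>j\<close> outside, the inner sum over \<open>i\<close> contains
        the decomposition of \<open>\<one>\<close> at \<open>t\<close> and collapses to
        \<open>V t' j \<otimes> x\<close>.\<close>
      then have "P t - (\<Sum>j\<in>{1..n t'}. \<Sum>i\<in>{1..n t}. frag_of (U t' j, w j i \<otimes> V t i)) \<in> ?N"
        by (subst sum.swap)
      moreover have "(\<Sum>j\<in>{1..n t'}. \<Sum>i\<in>{1..n t}. frag_of (U t' j, w j i \<otimes> V t i)) - Q t' \<in> ?N"
        unfolding Q_def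
      proof (rule null_sum)
        fix j assume j: "j \<in> {1..n t'}"
        have "(\<Oplus>i\<in>{1..n t}. w j i \<otimes> V t i) = (\<Oplus>i\<in>{1..n t}. V t' j \<otimes> x \<otimes> (u t i \<otimes> V t i))"
          using x u'[OF t] V[OF t] V[OF t' j] by (intro finsum_cong') (auto simp: w_def m_assoc)
        also have "\<dots> = V t' j \<otimes> x \<otimes> (\<Oplus>i\<in>{1..n t}. u t i \<otimes> V t i)"
          using x u'[OF t] V[OF t] V[OF t' j] by (intro finsum_rdistr[symmetric]) auto
        also have "\<dots> = V t' j \<otimes> x"
          using uv[OF tG(1)] x V[OF t' j] by (simp add: V_def)
        finally have sum: "(\<Oplus>i\<in>{1..n t}. w j i \<otimes> V t i) = V t' j \<otimes> x" .
        show "(\<Sum>i\<in>{1..n t}. frag_of (U t' j, w j i \<otimes> V t i)) - frag_of (U t' j, V t' j \<otimes> x) \<in> ?N"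
          unfolding sum[symmetric]
          by (rule null_sym[OF tensor_null_finsum_right[OF S]]) (use w[OF j] V[OF t] U[OF t' j] in auto)
      qed
      ultimately show ?thesis by (rule null_trans)
    qed
    \<comment> \<open>Left multiplication by \<open>g\<close> permutes the left cosets;
      \<open>\<sigma>\<close> is the induced map on representatives. It is injective by cancelling
      \<open>g\<close>, hence bijective on the finite set \<open>T\<close>.\<close>
    have "\<exists>\<sigma>. \<forall>t\<in>T. \<sigma> t \<in> T \<and> \<sigma> t \<in> g \<otimes>\<^bsub>G\<^esub> t <#\<^bsub>G\<^esub> H"
      using transversal_ex1 g T_carrier by (intro bchoice) (meson G.m_closed)
    then obtain \<sigma> where \<sigma>: "\<And>t. t \<in> T \<Longrightarrow> \<sigma> t \<in> T" "\<And>t. t \<in> T \<Longrightarrow> \<sigma> t \<in> g \<otimes>\<^bsub>G\<^esub> t <#\<^bsub>G\<^esub> H"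
      by blast
    have "inj_on \<sigma> T"
    proof (rule inj_onI)
      fix s t assume st: "s \<in> T" "t \<in> T" "\<sigma> s = \<sigma> t"
      then have sG: "s \<in> carrier G" "t \<in> carrier G" using T_carrier by auto
      have "g \<otimes>\<^bsub>G\<^esub> s <#\<^bsub>G\<^esub> H = g \<otimes>\<^bsub>G\<^esub> t <#\<^bsub>G\<^esub> H"
        using G.l_repr_independence[OF \<sigma>(2)[OF st(1)] _ H] G.l_repr_independence[OF \<sigma>(2)[OF st(2)] _ H]
          st(3) g sG by simp
      then have "g \<otimes>\<^bsub>G\<^esub> s \<in> g \<otimes>\<^bsub>G\<^esub> t <#\<^bsub>G\<^esub> H"
        using G.lcos_self[OF _ H, of "g \<otimes>\<^bsub>G\<^esub> s"] g sG by simp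
      moreover have "inv\<^bsub>G\<^esub> g \<otimes>\<^bsub>G\<^esub> (g \<otimes>\<^bsub>G\<^esub> s) = s"
        using g sG by (simp add: G.m_assoc[symmetric])
      ultimately have "inv\<^bsub>G\<^esub> t \<otimes>\<^bsub>G\<^esub> s \<in> H"
        using g sG by (simp add: mem_lcoset_iff[OF H] G.inv_mult_group G.m_assoc)
      then have "s \<in> t <#\<^bsub>G\<^esub> H" using sG by (simp add: mem_lcoset_iff[OF H])
      then show "s = t" using transversal_ex1[OF sG(2)] st G.lcos_self[OF sG(2) H] by blast
    qed
    then have bij: "bij_betw \<sigma> T T"
      using \<sigma>(1) endo_inj_surj[OF fin, of \<sigma>] by (simp add: bij_betw_def image_subset_iff)
    have "(\<Sum>t\<in>T. P t) - (\<Sum>t\<in>T. Q (\<sigma> t)) \<in> ?N"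
      using move \<sigma> by (intro null_sum) auto
    moreover have "(\<Sum>t\<in>T. Q (\<sigma> t)) = (\<Sum>t\<in>T. Q t)"
      by (rule sum.reindex_bij_betw[OF bij])
    moreover have "free_left R x c = (\<Sum>t\<in>T. P t)"
      by (simp add: c_def P_def free_left_sum[OF fin] free_left_sum free_left_simps)
    moreover have "free_right R x c = (\<Sum>t\<in>T. Q t)"
      by (simp add: c_def Q_def free_right_sum[OF fin] free_right_sum free_right_simps)
    ultimately show ?thesis by simp
  qed
  have "free_left R x c - free_right R x c \<in> ?N" if "x \<in> carrier R" for x
    using that
  proof (induction rule: graded_induct)
    case (homogeneous g x)
    then show ?case by (rule casimir)
  next
    case (add x y)
    have "(free_left R x c + free_left R y c) - (free_right R x c + free_right R y c) \<in> ?N"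
      using tensor_null_add[OF S add(3,4)] by (simp add: algebra_simps)
    \<comment> \<open>Additivity of the left action, the congruence for \<open>x\<close> and
      \<open>y\<close> separately, and additivity of the right action read backwards are
      chained.\<close>
    from null_trans[OF free_left_add[OF S add(1,2) c] null_trans[OF this null_sym[OF free_right_add[OF S add(1,2) c]]]]
    show ?case .
  qed
  then show ?thesis using separable_extension_iff[OF S] c mult by blast
qed

lemma separable_iff_trace:
  assumes "\<one> \<noteq> \<zero>"
  shows "separable_extension R (graded_part R A H) \<longleftrightarrow> finite (lcosets\<^bsub>G\<^esub> H) \<and>
    (\<exists>r \<in> centralizer_in R (A \<one>\<^bsub>G\<^esub>) (graded_part R A H). rel_trace G R n u v T r = \<one>)"
proof
  assume "separable_extension R (graded_part R A H)"
  then obtain c where "c \<in> carrier (pair_group R)" "free_mult R c = \<one>"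
    "\<And>x. x \<in> carrier R \<Longrightarrow> free_left R x c - free_right R x c \<in> tensor_null R (graded_part R A H)"
    using separable_extension_iff[OF graded_part_closed[OF subgroup.subset[OF H]]] by blast
  from separable_imp_trace[OF assms this]
  show "finite (lcosets\<^bsub>G\<^esub> H) \<and>
    (\<exists>r \<in> centralizer_in R (A \<one>\<^bsub>G\<^esub>) (graded_part R A H). rel_trace G R n u v T r = \<one>)"
    by (simp only: finite_transversal_iff)
next
  assume "finite (lcosets\<^bsub>G\<^esub> H) \<and>
    (\<exists>r \<in> centralizer_in R (A \<one>\<^bsub>G\<^esub>) (graded_part R A H). rel_trace G R n u v T r = \<one>)"
  then show "separable_extension R (graded_part R A H)"
    using trace_imp_separable finite_transversal_iff by blast
qed

end

theorem corollary33:
  fixes G :: "('g, 'm) monoid_scheme" and R :: "('r, 'k) ring_scheme"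
    and A :: "'g \<Rightarrow> 'r set" and H T :: "'g set"
    and n :: "'g \<Rightarrow> nat" and u v :: "'g \<Rightarrow> nat \<Rightarrow> 'r"
  assumes "strongly_graded_ring G R A"
    and "\<one>\<^bsub>R\<^esub> \<noteq> \<zero>\<^bsub>R\<^esub>"
    and "subgroup H G"
    and "\<And>g. g \<in> carrier G \<Longrightarrow> n g \<ge> 1"
    and "\<And>g i. \<lbrakk>g \<in> carrier G; 1 \<le> i; i \<le> n g\<rbrakk> \<Longrightarrow> u g i \<in> A g"
    and "\<And>g i. \<lbrakk>g \<in> carrier G; 1 \<le> i; i \<le> n g\<rbrakk> \<Longrightarrow> v (inv\<^bsub>G\<^esub> g) i \<in> A (inv\<^bsub>G\<^esub> g)"
    and "\<And>g. g \<in> carrier G \<Longrightarrow>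
          \<one>\<^bsub>R\<^esub> = (\<Oplus>\<^bsub>R\<^esub>i\<in>{1..n g}. u g i \<otimes>\<^bsub>R\<^esub> v (inv\<^bsub>G\<^esub> g) i)"
    and "left_transversal G H T"
  shows "separable_extension R (graded_part R A H) \<longleftrightarrow>
    finite (lcosets\<^bsub>G\<^esub> H) \<and>
    (\<exists>r \<in> centralizer_in R (A \<one>\<^bsub>G\<^esub>) (graded_part R A H). rel_trace G R n u v T r = \<one>\<^bsub>R\<^esub>)"
proof -
  have graded: "graded_ring G R A"
    using assms(1) by (rule strongly_graded_ring.axioms(1))
  interpret graded_transversal G R A H T n u v
    by (intro graded_transversal.intro grading.intro grading_axioms.intro
        graded_transversal_axioms.intro graded graded_ring.axioms(1,2)[OF graded] assms(3,8)
        assms(7)[symmetric])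
      (simp_all add: assms(5,6))
  show ?thesis using assms(2) by (rule separable_iff_trace)
qed

end
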